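(* Assume that the discrete solutions $\mathbf{U}_{\mathbf j}^n=(u_{\mathbf j}^n,\psi_{\mathbf j}^n,\mathbf q_{\mathbf j}^n,w_{\mathbf j}^n,\mathbf p_{\mathbf j}^n)$ obtained from the scheme (P)-(C) described in the context have, for all $\mathbf j,n$, an asymptotic expansion $$\mathbf U_{\mathbf j}^n=\mathbf U_{\mathbf j}^{n,(0)}+\epsilon\,\mathbf U_{\mathbf j}^{n,(1)}+\epsilon^2\,\mathbf U_{\mathbf j}^{n,(2)}+\cdots,\qquad \mathbf U_{\mathbf j}^{n,(k)}=\big(u_{\mathbf j}^{n,(k)},\psi_{\mathbf j}^{n,(k)},\mathbf q_{\mathbf j}^{n,(k)},w_{\mathbf j}^{n,(k)},\mathbf p_{\mathbf j}^{n,(k)}\big),\quad k=0,1,2,\dots$$ Assume furthermore that the numerical solution $\mathbf U^n$ at the $n$-th step is well-prepared. Then, in the relaxation limit $\epsilon\to0$, the scheme (P)-(C) becomes a consistent numerical approximation of the fourth-order equation $$u_t+\nabla\cdot\big(\mathcal M(u)\nabla(\gamma\Delta u-\Pi(u))\big)=0$$ with periodic boundary conditions.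
   Context: **Grid.** Fix $d,N\in\mathbb{N}$, $a<b$, $\Omega=(a,b)^d$ with periodic boundary conditions, $\Delta x=(b-a)/N$, time step $\Delta t>0$. Grid points are indexed by $\mathbf{j}=(j_1,\dots,j_d)$, $0\le j_\alpha\le N-1$, with indices understood periodically (mod $N$); $\mathbf{e}_\alpha$ is the unit multi-index in direction $\alpha$. For scalar grid functions $f$: $(D_\alpha^+f)_{\mathbf j}=(f_{\mathbf j+\mathbf e_\alpha}-f_{\mathbf j})/\Delta x$, $(D_\alpha^-f)_{\mathbf j}=(f_{\mathbf j}-f_{\mathbf j-\mathbf e_\alpha})/\Delta x$, $(\nabla_h^+f)_{\mathbf j}=((D_1^+f)_{\mathbf j},\dots,(D_d^+f)_{\mathbf j})$. For vector grid functions $\mathbf v=(v^1,\dots,v^d)$: $(\nabla_h^-\cdot\mathbf v)_{\mathbf j}=\sum_{\alpha=1}^d(D_\alpha^-v^\alpha)_{\mathbf j}$. $\Delta_h=\nabla_h^-\cdot\nabla_h^+$ on scalar grid functions, applied componentwise to vector grid functions. **Data.** $\epsilon\in(0,1]$, $\gamma>0$, and $$r=c_{\mathbf q}\Delta x,\quad s=c_w\Delta x,\quad r_1=c_u\epsilon\Delta t,\quad r_2=c_\psi\Delta t,\quad r_3=c_{\mathbf p}\epsilon d\gamma\Delta t,$$ with constants $c_{\mathbf q},c_w>0$ and $c_u,c_\psi,c_{\mathbf p}>1$ independent of $\epsilon,\Delta x,\Delta t$. Standing assumptions, with constants $L,m_0,\delta>0$: $\mathcal M:\mathbb R\to\mathbb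 R_+$ is $C^\infty$ with $\max_{\mathbb R}|\mathcal M'|<L$ and $\mathcal M(v)>1/m_0$ for $v\in[0,\infty)$; $\Pi:\mathbb R\to\mathbb R$ is $C^\infty$ with $\max_{\mathbb R}|\Pi'|,\max_{\mathbb R}|\Pi''|<L$ and $\Pi'(v)\ge\delta$ for $v\in[0,\infty)$. $W$ is a primitive of $\Pi$ ($W'=\Pi$), convex. Notation: $\Pi^n_{\mathbf j}=\Pi(u^n_{\mathbf j})$, $\Pi^*_{\mathbf j}=\Pi(u^*_{\mathbf j})$, $\mathcal M^n_{\mathbf j}=\mathcal M(u^n_{\mathbf j})>0$. **Scheme.** $u,\psi,w$ are scalar and $\mathbf q,\mathbf p$ are $\mathbb R^d$-valued periodic grid functions. Given $\mathbf U^n$, the intermediate state $\mathbf U^*=(u^*,\psi^*,\mathbf q^*,w^*,\mathbf p^* )$ solves, for all $\mathbf j$, (P) implicit predictor step: $$\frac{u^*_{\mathbf j}-u^n_{\mathbf j}}{\Delta t}=0,\qquad \frac{\psi^*_{\mathbf j}-\psi^n_{\mathbf j}}{\Delta t}=-\frac1\epsilon\big(w^*_{\mathbf j}+(1-\epsilon)(\nabla_h^-\cdot\mathbf q^* )_{\mathbf j}\big),$$ $$\frac{\mathbf q^*_{\mathbf j}-\mathbf q^n_{\mathbf j}}{\Delta t}=-\frac1\epsilon\Big(\frac{\mathbf q^*_{\mathbf j}}{\mathcal M^n_{\mathbf j}}+(1-\epsilon)(\nabla_h^+(\Pi^*+\psi^* ))_{\mathbf j}-r(\Delta_h\mathbf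 q^* )_{\mathbf j}\Big),$$ $$\frac{w^*_{\mathbf j}-w^n_{\mathbf j}}{\Delta t}=\frac1\epsilon\big(\psi^*_{\mathbf j}+\gamma(1-\epsilon)(\nabla_h^-\cdot\mathbf p^* )_{\mathbf j}+s(\Delta_hw^* )_{\mathbf j}\big),\qquad \frac{\mathbf p^*_{\mathbf j}-\mathbf p^n_{\mathbf j}}{\Delta t}=0;$$ (C) explicit corrector step: $$\frac{u^{n+1}_{\mathbf j}-u^*_{\mathbf j}}{\Delta t}+(\nabla_h^-\cdot\mathbf q^* )_{\mathbf j}=r_1(\Delta_h\Pi^* )_{\mathbf j},\qquad \frac{\psi^{n+1}_{\mathbf j}-\psi^*_{\mathbf j}}{\Delta t}+(\nabla_h^-\cdot\mathbf q^* )_{\mathbf j}=r_2(\Delta_h\psi^* )_{\mathbf j},$$ $$\frac{\mathbf q^{n+1}_{\mathbf j}-\mathbf q^*_{\mathbf j}}{\Delta t}+(\nabla_h^+(\Pi^*+\psi^* ))_{\mathbf j}=0,\qquad \frac{w^{n+1}_{\mathbf j}-w^*_{\mathbf j}}{\Delta t}-\gamma(\nabla_h^-\cdot\mathbf p^* )_{\mathbf j}=0,$$ $$\frac{\mathbf p^{n+1}_{\mathbf j}-\mathbf p^*_{\mathbf j}}{\Delta t}-(\nabla_h^+w^* )_{\mathbf j}=r_3(\Delta_h\mathbf p^* )_{\mathbf j}.$$ **Well-prepared.** The state $\mathbf U^n$ is well-prepared if, as $\epsilon\to0$, $$\nabla_h^-\cdot\mathbf q^n+w^n=O(\epsilon),\quad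 \mathbf q^n+\mathcal M(u^n)\nabla_h^+(\Pi(u^n)+\psi^n)=O(\epsilon),\quad \psi^n+\gamma\nabla_h^-\cdot\mathbf p^n=O(\epsilon),\quad \mathbf p^n=\nabla_h^+u^n+O(\epsilon),$$ and the energy $\sum_{\mathbf j}\Delta x^d\big(W(u^n_{\mathbf j})+\tfrac\epsilon2|\psi^n_{\mathbf j}|^2+\tfrac\epsilon2|\mathbf q^n_{\mathbf j}|^2+\tfrac\epsilon2|w^n_{\mathbf j}|^2+\tfrac\gamma2|\mathbf p^n_{\mathbf j}|^2\big)$ is bounded by a constant independent of $\epsilon$. **Consistency.** "Becomes a consistent numerical approximation in the limit $\epsilon\to0$" means: letting $\epsilon\to0$ with $\Delta t,\Delta x$ fixed, the leading-order terms satisfy a discrete scheme advancing $u^{n,(0)}$ to $u^{n+1,(0)}$ whose local truncation error, evaluated on smooth positive solutions of the fourth-order equation, tends to $0$ as $\Delta t,\Delta x\to0$. *)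

theory Defs
  imports "HOL-Analysis.Analysis" "HOL-Library.Landau_Symbols"
begin

text \<open>For an open set \<open>S\<close> in finite dimension this is the usual class of \<open>k\<close> times continuously
  differentiable functions: all iterated directional derivatives up to order \<open>k\<close> exist and are
  continuous.\<close>

primrec Ck_on :: "nat \<Rightarrow> 'a::real_normed_vector set \<Rightarrow> ('a \<Rightarrow> 'b::real_normed_vector) \<Rightarrow> bool" where
  "Ck_on 0 S f \<longleftrightarrow> continuous_on S f"
| "Ck_on (Suc k) S f \<longleftrightarrow>
     (\<forall>x\<in>S. f differentiable (at x)) \<and> (\<forall>v. Ck_on k S (\<lambda>x. frechet_derivative f (at x) v))"

definition smooth_on :: "'a::real_normed_vector set \<Rightarrow> ('a \<Rightarrow> 'b::real_normed_vector) \<Rightarrow> bool" where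
  "smooth_on S f \<longleftrightarrow> (\<forall>k. Ck_on k S f)"

record model =
  gam  :: real
  mob  :: "real \<Rightarrow> real"    \<comment> \<open>the mobility \<open>M\<close>\<close>
  pot  :: "real \<Rightarrow> real"    \<comment> \<open>\<open>\<Pi>\<close>\<close>
  prim :: "real \<Rightarrow> real"    \<comment> \<open>\<open>W\<close>\<close>
  cq   :: real
  cw   :: real
  cu   :: real
  cpsi :: real
  cp   :: real

definition standing_assumptions :: "model \<Rightarrow> bool" where
  "standing_assumptions P \<longleftrightarrow>
     gam P > 0 \<and> cq P > 0 \<and> cw P > 0 \<and> cu P > 1 \<and> cpsi P > 1 \<and> cp P > 1 \<and>
     smooth_on UNIV (mob P) \<and> (\<forall>v. mob P v > 0) \<and> smooth_on UNIV (pot P) \<and>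
     (\<exists>L>0. \<exists>m0>0. \<exists>\<delta>>0.
        (\<forall>v. \<bar>deriv (mob P) v\<bar> < L) \<and>
        (\<forall>v\<ge>0. mob P v > 1 / m0) \<and>
        (\<forall>v. \<bar>deriv (pot P) v\<bar> < L) \<and>
        (\<forall>v. \<bar>deriv (deriv (pot P)) v\<bar> < L) \<and>
        (\<forall>v\<ge>0. deriv (pot P) v \<ge> \<delta>)) \<and>
     (\<forall>v. (prim P has_real_derivative pot P v) (at v)) \<and> convex_on UNIV (prim P)"

text \<open>Grid functions are functions on the integer lattice that are \<open>N\<close>-periodic in every
  coordinate direction. The dimension \<open>d\<close> is \<open>CARD('d)\<close>, and \<open>axis \<alpha> 1\<close> is the unit multi-index
  in direction \<open>\<alpha>\<close>.\<close>

definition grid_periodic :: "nat \<Rightarrow> (int^'d::finite \<Rightarrow> 'b) \<Rightarrow> bool" where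
  "grid_periodic N f \<longleftrightarrow> (\<forall>j \<alpha>. f (j + axis \<alpha> (int N)) = f j)"

definition grid_cell :: "nat \<Rightarrow> (int^'d::finite) set" where
  "grid_cell N = {j. \<forall>\<alpha>. 0 \<le> j $ \<alpha> \<and> j $ \<alpha> < int N}"

definition D_plus :: "real \<Rightarrow> 'd \<Rightarrow> (int^'d::finite \<Rightarrow> real) \<Rightarrow> int^'d \<Rightarrow> real" where
  "D_plus dx \<alpha> f j = (f (j + axis \<alpha> 1) - f j) / dx"

definition D_minus :: "real \<Rightarrow> 'd \<Rightarrow> (int^'d::finite \<Rightarrow> real) \<Rightarrow> int^'d \<Rightarrow> real" where
  "D_minus dx \<alpha> f j = (f j - f (j - axis \<alpha> 1)) / dx"

definition grad_h :: "real \<Rightarrow> (int^'d::finite \<Rightarrow> real) \<Rightarrow> int^'d \<Rightarrow> real^'d" where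
  "grad_h dx f j = (\<chi> \<alpha>. D_plus dx \<alpha> f j)"

definition div_h :: "real \<Rightarrow> (int^'d::finite \<Rightarrow> real^'d) \<Rightarrow> int^'d \<Rightarrow> real" where
  "div_h dx v j = (\<Sum>\<alpha>\<in>UNIV. D_minus dx \<alpha> (\<lambda>i. v i $ \<alpha>) j)"

definition lap_h :: "real \<Rightarrow> (int^'d::finite \<Rightarrow> real) \<Rightarrow> int^'d \<Rightarrow> real" where
  "lap_h dx f = div_h dx (grad_h dx f)"

definition vlap_h :: "real \<Rightarrow> (int^'d::finite \<Rightarrow> real^'d) \<Rightarrow> int^'d \<Rightarrow> real^'d" where
  "vlap_h dx v j = (\<chi> \<beta>. lap_h dx (\<lambda>i. v i $ \<beta>) j)"

record ('d::finite) state =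
  st_u  :: "int^'d \<Rightarrow> real"
  st_psi :: "int^'d \<Rightarrow> real"
  st_q  :: "int^'d \<Rightarrow> real^'d"
  st_w  :: "int^'d \<Rightarrow> real"
  st_p  :: "int^'d \<Rightarrow> real^'d"

definition state_periodic :: "nat \<Rightarrow> ('d::finite) state \<Rightarrow> bool" where
  "state_periodic N X \<longleftrightarrow> grid_periodic N (st_u X) \<and> grid_periodic N (st_psi X) \<and>
     grid_periodic N (st_q X) \<and> grid_periodic N (st_w X) \<and> grid_periodic N (st_p X)"

text \<open>\<open>X\<close> is the state \<open>U\<^sup>n\<close> and \<open>Y\<close> the intermediate state \<open>U\<^sup>*\<close>.\<close>

definition predictor ::
  "model \<Rightarrow> real \<Rightarrow> real \<Rightarrow> real \<Rightarrow> ('d::finite) state \<Rightarrow> 'd state \<Rightarrow> bool" where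
  "predictor P dx dt \<epsilon> X Y \<longleftrightarrow> (let r = cq P * dx; s = cw P * dx in \<forall>j.
     (st_u Y j - st_u X j) / dt = 0 \<and>
     (st_psi Y j - st_psi X j) / dt = - (1 / \<epsilon>) * (st_w Y j + (1 - \<epsilon>) * div_h dx (st_q Y) j) \<and>
     (1 / dt) *\<^sub>R (st_q Y j - st_q X j) = - (1 / \<epsilon>) *\<^sub>R
        ((1 / mob P (st_u X j)) *\<^sub>R st_q Y j
          + (1 - \<epsilon>) *\<^sub>R grad_h dx (\<lambda>i. pot P (st_u Y i) + st_psi Y i) j
          - r *\<^sub>R vlap_h dx (st_q Y) j) \<and>
     (st_w Y j - st_w X j) / dt = (1 / \<epsilon>) *
        (st_psi Y j + gam P * (1 - \<epsilon>) * div_h dx (st_p Y) j + s * lap_h dx (st_w Y) j) \<and>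
     (1 / dt) *\<^sub>R (st_p Y j - st_p X j) = 0)"

text \<open>\<open>Y\<close> is the intermediate state \<open>U\<^sup>*\<close> and \<open>Z\<close> the new state.\<close>

definition corrector ::
  "model \<Rightarrow> real \<Rightarrow> real \<Rightarrow> real \<Rightarrow> ('d::finite) state \<Rightarrow> 'd state \<Rightarrow> bool" where
  "corrector P dx dt \<epsilon> Y Z \<longleftrightarrow>
    (let r1 = cu P * \<epsilon> * dt; r2 = cpsi P * dt;
         r3 = cp P * \<epsilon> * real CARD('d) * gam P * dt in \<forall>j.
     (st_u Z j - st_u Y j) / dt + div_h dx (st_q Y) j = r1 * lap_h dx (\<lambda>i. pot P (st_u Y i)) j \<and>
     (st_psi Z j - st_psi Y j) / dt + div_h dx (st_q Y) j = r2 * lap_h dx (st_psi Y) j \<and>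
     (1 / dt) *\<^sub>R (st_q Z j - st_q Y j) + grad_h dx (\<lambda>i. pot P (st_u Y i) + st_psi Y i) j = 0 \<and>
     (st_w Z j - st_w Y j) / dt - gam P * div_h dx (st_p Y) j = 0 \<and>
     (1 / dt) *\<^sub>R (st_p Z j - st_p Y j) - grad_h dx (st_w Y) j = r3 *\<^sub>R vlap_h dx (st_p Y) j)"

text \<open>A family of discrete solutions, one for each \<open>\<epsilon> \<in> (0,1]\<close>, on a fixed grid: \<open>U \<epsilon> n\<close> is the
  state at step \<open>n\<close>, and \<open>V \<epsilon> n\<close> the intermediate state between the steps \<open>n\<close> and \<open>n + 1\<close>.\<close>

definition discrete_solution ::
  "model \<Rightarrow> nat \<Rightarrow> real \<Rightarrow> real \<Rightarrow> (real \<Rightarrow> nat \<Rightarrow> ('d::finite) state) \<Rightarrow>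
     (real \<Rightarrow> nat \<Rightarrow> 'd state) \<Rightarrow> bool" where
  "discrete_solution P N dx dt U V \<longleftrightarrow> (\<forall>\<epsilon>\<in>{0<..1}. \<forall>n.
     state_periodic N (U \<epsilon> n) \<and> state_periodic N (V \<epsilon> n) \<and>
     predictor P dx dt \<epsilon> (U \<epsilon> n) (V \<epsilon> n) \<and> corrector P dx dt \<epsilon> (V \<epsilon> n) (U \<epsilon> (Suc n)))"

text \<open>The expansion is a (not necessarily convergent) Poincare expansion.\<close>

definition has_expansion :: "(real \<Rightarrow> 'b::real_normed_vector) \<Rightarrow> (nat \<Rightarrow> 'b) \<Rightarrow> bool" where
  "has_expansion f c \<longleftrightarrow>
     (\<forall>K. (\<lambda>\<epsilon>. norm (f \<epsilon> - (\<Sum>k<K. \<epsilon> ^ k *\<^sub>R c k))) \<in> O[at_right 0](\<lambda>\<epsilon>. \<epsilon> ^ K))"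

definition state_expansion :: "(real \<Rightarrow> ('d::finite) state) \<Rightarrow> (nat \<Rightarrow> 'd state) \<Rightarrow> bool" where
  "state_expansion X C \<longleftrightarrow> (\<forall>j.
     has_expansion (\<lambda>\<epsilon>. st_u (X \<epsilon>) j) (\<lambda>k. st_u (C k) j) \<and>
     has_expansion (\<lambda>\<epsilon>. st_psi (X \<epsilon>) j) (\<lambda>k. st_psi (C k) j) \<and>
     has_expansion (\<lambda>\<epsilon>. st_q (X \<epsilon>) j) (\<lambda>k. st_q (C k) j) \<and>
     has_expansion (\<lambda>\<epsilon>. st_w (X \<epsilon>) j) (\<lambda>k. st_w (C k) j) \<and>
     has_expansion (\<lambda>\<epsilon>. st_p (X \<epsilon>) j) (\<lambda>k. st_p (C k) j))"

definition energy :: "model \<Rightarrow> nat \<Rightarrow> real \<Rightarrow> real \<Rightarrow> ('d::finite) state \<Rightarrow> real" where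
  "energy P N dx \<epsilon> X = (\<Sum>j\<in>grid_cell N. dx ^ CARD('d) *
     (prim P (st_u X j) + \<epsilon> / 2 * (st_psi X j)\<^sup>2 + \<epsilon> / 2 * (norm (st_q X j))\<^sup>2
        + \<epsilon> / 2 * (st_w X j)\<^sup>2 + gam P / 2 * (norm (st_p X j))\<^sup>2))"

definition well_prepared :: "model \<Rightarrow> nat \<Rightarrow> real \<Rightarrow> (real \<Rightarrow> ('d::finite) state) \<Rightarrow> bool" where
  "well_prepared P N dx X \<longleftrightarrow>
     (\<forall>j. (\<lambda>\<epsilon>. div_h dx (st_q (X \<epsilon>)) j + st_w (X \<epsilon>) j) \<in> O[at_right 0](\<lambda>\<epsilon>. \<epsilon>)) \<and>
     (\<forall>j. (\<lambda>\<epsilon>. norm (st_q (X \<epsilon>) j + mob P (st_u (X \<epsilon>) j) *\<^sub>R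
              grad_h dx (\<lambda>i. pot P (st_u (X \<epsilon>) i) + st_psi (X \<epsilon>) i) j)) \<in> O[at_right 0](\<lambda>\<epsilon>. \<epsilon>)) \<and>
     (\<forall>j. (\<lambda>\<epsilon>. st_psi (X \<epsilon>) j + gam P * div_h dx (st_p (X \<epsilon>)) j) \<in> O[at_right 0](\<lambda>\<epsilon>. \<epsilon>)) \<and>
     (\<forall>j. (\<lambda>\<epsilon>. norm (st_p (X \<epsilon>) j - grad_h dx (st_u (X \<epsilon>)) j)) \<in> O[at_right 0](\<lambda>\<epsilon>. \<epsilon>)) \<and>
     (\<exists>C. \<forall>\<epsilon>\<in>{0<..1}. energy P N dx \<epsilon> (X \<epsilon>) \<le> C)"

definition pderiv_at :: "'d \<Rightarrow> (real^'d::finite \<Rightarrow> real) \<Rightarrow> real^'d \<Rightarrow> real" where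
  "pderiv_at \<alpha> f x = deriv (\<lambda>h. f (x + h *\<^sub>R axis \<alpha> 1)) 0"

definition grad :: "(real^'d::finite \<Rightarrow> real) \<Rightarrow> real^'d \<Rightarrow> real^'d" where
  "grad f x = (\<chi> \<alpha>. pderiv_at \<alpha> f x)"

definition divergence :: "(real^'d::finite \<Rightarrow> real^'d) \<Rightarrow> real^'d \<Rightarrow> real" where
  "divergence F x = (\<Sum>\<alpha>\<in>UNIV. pderiv_at \<alpha> (\<lambda>y. F y $ \<alpha>) x)"

definition laplacian :: "(real^'d::finite \<Rightarrow> real) \<Rightarrow> real^'d \<Rightarrow> real" where
  "laplacian f = divergence (grad f)"

text \<open>A smooth positive solution on the time interval \<open>[0,T]\<close>, given by its periodic extension
  from the box \<open>(a,b)\<^sup>d\<close> to the whole space. Smoothness up to the end points of \<open>[0,T]\<close> is expressed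
  by a smooth extension to an open time set \<open>S\<close>; nothing else is required outside \<open>[0,T]\<close>.\<close>

definition smooth_positive_solution ::
  "model \<Rightarrow> real \<Rightarrow> real \<Rightarrow> real \<Rightarrow> (real \<Rightarrow> real^'d::finite \<Rightarrow> real) \<Rightarrow> bool" where
  "smooth_positive_solution P a b T v \<longleftrightarrow>
     (\<exists>S. open S \<and> {0..T} \<subseteq> S \<and> smooth_on (S \<times> UNIV) (\<lambda>(t, x). v t x)) \<and>
     (\<forall>t\<in>{0..T}. \<forall>x.
        v t x > 0 \<and>
        (\<forall>\<alpha>. v t (x + axis \<alpha> (b - a)) = v t x) \<and>
        deriv (\<lambda>\<tau>. v \<tau> x) t
          + divergence (\<lambda>y. mob P (v t y) *\<^sub>R
              grad (\<lambda>z. gam P * laplacian (v t) z - pot P (v t z)) y) x = 0)"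

definition grid_point :: "real \<Rightarrow> real \<Rightarrow> int^'d::finite \<Rightarrow> real^'d" where
  "grid_point a dx j = (\<chi> \<alpha>. a + real_of_int (j $ \<alpha>) * dx)"

text \<open>A one-step scheme \<open>\<Phi>\<close> maps a grid function on the grid with \<open>N\<close> points per direction to
  its update after one time step of length \<open>dt\<close>.\<close>

type_synonym 'd one_step = "nat \<Rightarrow> real \<Rightarrow> (int^'d \<Rightarrow> real) \<Rightarrow> int^'d \<Rightarrow> real"

definition truncation_error ::
  "real \<Rightarrow> real \<Rightarrow> ('d::finite) one_step \<Rightarrow> (real \<Rightarrow> real^'d \<Rightarrow> real) \<Rightarrow> nat \<Rightarrow> real \<Rightarrow> real \<Rightarrow>
     int^'d \<Rightarrow> real" where
  "truncation_error a b \<Phi> v N dt t j = (let x = grid_point a ((b - a) / real N) in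
     (v (t + dt) (x j) - \<Phi> N dt (\<lambda>i. v t (x i)) j) / dt)"

text \<open>The truncation error tends to 0 in the maximum norm over all grid points and time levels
  in \<open>[0,T]\<close>, as \<open>N\<close> tends to infinity and \<open>dt\<close> to 0 independently.\<close>

definition consistent :: "model \<Rightarrow> real \<Rightarrow> real \<Rightarrow> ('d::finite) one_step \<Rightarrow> bool" where
  "consistent P a b \<Phi> \<longleftrightarrow>
     (\<forall>T v. T > 0 \<and> smooth_positive_solution P a b T v \<longrightarrow>
       (\<forall>\<eta>>0. \<forall>\<^sub>F (N, dt) in sequentially \<times>\<^sub>F at_right 0.
          \<forall>t\<in>{0..T - dt}. \<forall>j. \<bar>truncation_error a b \<Phi> v N dt t j\<bar> < \<eta>))"

end

theory Submission
  imports Defs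
begin

text \<open>Write \<open>h\<close> for the mesh width. The intermediate state is never assumed to converge, but it is
  an explicit function of data that do: the corrector gives \<open>w\<^sup>*\<close> from the two states at steps \<open>n\<close> and
  \<open>n + 1\<close>, then the predictor equation for \<open>w\<close> gives \<open>\<psi>\<^sup>*\<close>, and the corrector equation for \<open>\<^bold>q\<close>
  gives \<open>\<^bold>q\<^sup>*\<close>. Passing to the limit in the predictor and eliminating \<open>w\<^sup>* = - div\<^sub>h \<^bold>q\<^sup>*\<close> and
  \<open>\<psi>\<^sup>* = - \<gamma> \<Delta>\<^sub>h u + s \<Delta>\<^sub>h div\<^sub>h \<^bold>q\<^sup>*\<close>, where well-preparedness supplies \<open>\<^bold>p = grad\<^sub>h u\<close>, leaves one
  linear equation for the limit flux,
  \<open>\<^bold>q / M(u) - r \<Delta>\<^sub>h \<^bold>q + s grad\<^sub>h \<Delta>\<^sub>h div\<^sub>h \<^bold>q = grad\<^sub>h (\<gamma> \<Delta>\<^sub>h u - \<Pi>(u))\<close>,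
  while the corrector becomes \<open>u\<^sup>n\<^sup>+\<^sup>1 = u\<^sup>n - \<Delta>t div\<^sub>h \<^bold>q\<close> (lemma \<open>relaxation_limit\<close>).

  Summation by parts makes the operator on the left coercive: the two terms with \<open>r\<close> and \<open>s\<close> are
  the stabilising ones, and they are nonnegative in the discrete energy. So the flux equation is
  injective on periodic grid functions, hence uniquely solvable, and it defines the one-step map
  \<open>limit_scheme\<close> (lemmas \<open>flux_op_stable\<close>, \<open>flux_op_surjective\<close>).

  For consistency, \<open>r\<close> and \<open>s\<close> are of order \<open>h\<close>, so the flux equation is a perturbation of
  \<open>\<^bold>q = M(u) grad (\<gamma> \<Delta>u - \<Pi>(u))\<close>. Coercivity only controls the flux error in the mean square, whereas the
  truncation error contains its discrete divergence in the maximum norm; passing from one to the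
  other costs the factor \<open>h\<close> to the power \<open>- d/2 - 1\<close>. This loss is compensated by comparing
  with an approximate flux whose residual is of arbitrarily high order in \<open>h\<close>. It is built by
  defect correction (lemma \<open>defect_correction\<close>): a residual \<open>h\<^sup>K \<rho>\<close> is removed by subtracting
  \<open>h\<^sup>K M \<rho>\<close>, which leaves a residual with one more power of \<open>h\<close>, provided that all difference
  quotients of \<open>\<rho>\<close> stay bounded as \<open>h\<close> tends to 0. That is why the calculus below is carried
  out in the class \<open>smooth_family\<close> of families of functions all of whose partial derivatives are
  uniformly bounded, a class stable under products, difference quotients, and their
  remainders.\<close>

section \<open>Periodic grid functions and summation by parts\<close>

text \<open>Stated over a ring, so that it covers the lattice of grid indices as well as the space itself.\<close>

lemma periodic_integer_combination:
  fixes f :: "('a::comm_ring_1)^'d::finite \<Rightarrow> 'b"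
  assumes per: "\<And>x \<alpha>. f (x + axis \<alpha> L) = f x"
  shows "f (x + (\<chi> \<alpha>. of_int (m \<alpha>) * L)) = f x"
proof -
  have nat: "f (x + axis \<alpha> (of_nat k * L)) = f x" for x \<alpha> k
  proof (induction k)
    case 0
    have "axis \<alpha> 0 = (0 :: 'a^'d)" by (simp add: vec_eq_iff axis_def)
    show ?case by (simp add: \<open>axis \<alpha> 0 = 0\<close>)
  next
    case (Suc k)
    have "x + axis \<alpha> (of_nat (Suc k) * L) = (x + axis \<alpha> (of_nat k * L)) + axis \<alpha> L"
      by (simp add: vec_eq_iff axis_def algebra_simps)
    then show ?case using Suc per by metis
  qed
  have int: "f (x + axis \<alpha> (of_int k * L)) = f x" for x \<alpha> k
  proof (cases "k \<ge> 0")
    case True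
    then show ?thesis using nat[of x \<alpha> "nat k"] by simp
  next
    case False
    have "(x + axis \<alpha> (of_int k * L)) + axis \<alpha> (of_nat (nat (- k)) * L) = x"
      using False by (simp add: vec_eq_iff axis_def)
    then show ?thesis using nat by metis
  qed
  have "f (x + (\<Sum>\<alpha>\<in>S. axis \<alpha> (of_int (m \<alpha>) * L))) = f x" if "finite S" for S
    using that
  proof (induction S)
    case (insert \<beta> S)
    have split: "x + (\<Sum>\<alpha>\<in>insert \<beta> S. axis \<alpha> (of_int (m \<alpha>) * L))
      = (x + (\<Sum>\<alpha>\<in>S. axis \<alpha> (of_int (m \<alpha>) * L))) + axis \<beta> (of_int (m \<beta>) * L)"
      using insert by (simp add: algebra_simps)
    show ?case unfolding split int by (rule insert.IH)
  qed simp
  moreover have "(\<Sum>\<alpha>\<in>UNIV. axis \<alpha> (of_int (m \<alpha>) * L)) = (\<chi> \<alpha>. of_int (m \<alpha>) * L)"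
    by (simp add: vec_eq_iff axis_def)
  ultimately show ?thesis by (metis finite)
qed

definition wrap :: "nat \<Rightarrow> int^'d::finite \<Rightarrow> int^'d" where
  "wrap N j = (\<chi> \<alpha>. j $ \<alpha> mod int N)"

text \<open>Every identity between periodic grid functions may therefore be checked on one cell.\<close>

lemma grid_periodic_wrap:
  assumes "grid_periodic N f"
  shows "f (wrap N j) = f j"
proof -
  have "wrap N j + (\<chi> \<alpha>. of_int (j $ \<alpha> div int N) * int N) = j"
    by (simp add: vec_eq_iff wrap_def)
  then show ?thesis
    using periodic_integer_combination[of f "int N" "wrap N j" "\<lambda>\<alpha>. j $ \<alpha> div int N"] assms
    unfolding grid_periodic_def by metis
qed

lemma wrap_in_cell: "N > 0 \<Longrightarrow> wrap N j \<in> grid_cell N"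
  by (simp add: wrap_def grid_cell_def)

lemma wrap_cell_id: "j \<in> grid_cell N \<Longrightarrow> wrap N j = j"
  by (simp add: wrap_def grid_cell_def vec_eq_iff)

lemma grid_periodic_eqI:
  assumes "grid_periodic N f" "grid_periodic N g" "N > 0" "\<And>j. j \<in> grid_cell N \<Longrightarrow> f j = g j"
  shows "f = g"
  using assms by (metis ext grid_periodic_wrap wrap_in_cell)

lemma grid_cell_image:
  "grid_cell N \<subseteq> vec_lambda ` (UNIV \<rightarrow>\<^sub>E {0..<int N})"
proof
  fix j :: "int^'d" assume "j \<in> grid_cell N"
  then have "vec_nth j \<in> UNIV \<rightarrow>\<^sub>E {0..<int N}" by (auto simp: grid_cell_def)
  then show "j \<in> vec_lambda ` (UNIV \<rightarrow>\<^sub>E {0..<int N})" by (metis image_eqI vec_nth_inverse)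
qed

lemma finite_grid_cell: "finite (grid_cell N)"
  by (rule finite_subset[OF grid_cell_image]) (simp add: finite_PiE)

lemma card_grid_cell_le: "card (grid_cell N :: (int^'d::finite) set) \<le> N ^ CARD('d)"
proof -
  have fin: "finite (UNIV \<rightarrow>\<^sub>E {0..<int N} :: ('d \<Rightarrow> int) set)" by (simp add: finite_PiE)
  have "card (grid_cell N :: (int^'d) set) \<le> card (UNIV \<rightarrow>\<^sub>E {0..<int N} :: ('d \<Rightarrow> int) set)"
    using card_mono[OF finite_imageI[OF fin] grid_cell_image] card_image_le[OF fin] by (rule le_trans)
  also have "\<dots> = N ^ CARD('d)" by (simp add: card_PiE)
  finally show ?thesis .
qed

text \<open>Translation followed by reduction modulo \<open>N\<close> is a permutation of the cell.\<close>

lemma sum_cell_shift: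
  fixes f :: "int^'d::finite \<Rightarrow> 'b::comm_monoid_add"
  assumes "grid_periodic N f" "N > 0"
  shows "(\<Sum>j\<in>grid_cell N. f (j + axis \<alpha> 1)) = (\<Sum>j\<in>grid_cell N. f j)"
proof (rule sum.reindex_bij_witness[where i = "\<lambda>j. wrap N (j - axis \<alpha> 1)" and j = "\<lambda>j. wrap N (j + axis \<alpha> 1)"])
  fix j :: "int^'d" assume j: "j \<in> grid_cell N"
  show "wrap N (wrap N (j + axis \<alpha> 1) - axis \<alpha> 1) = j"
    using j by (simp add: wrap_def grid_cell_def vec_eq_iff mod_diff_left_eq)
  show "wrap N (wrap N (j - axis \<alpha> 1) + axis \<alpha> 1) = j"
    using j by (simp add: wrap_def grid_cell_def vec_eq_iff mod_add_left_eq)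
qed (use assms in \<open>simp_all add: wrap_in_cell grid_periodic_wrap\<close>)

lemma grid_periodic_shift_plus: "grid_periodic N f \<Longrightarrow> grid_periodic N (\<lambda>j. f (j + c))"
  unfolding grid_periodic_def by (metis add.commute add.left_commute)

lemma grid_periodic_shift_minus: "grid_periodic N f \<Longrightarrow> grid_periodic N (\<lambda>j. f (j - c))"
  using grid_periodic_shift_plus[of N f "- c"] by simp

lemma grid_periodic_D_plus: "grid_periodic N f \<Longrightarrow> grid_periodic N (D_plus dx \<alpha> f)"
  using grid_periodic_shift_plus[of N f "axis \<alpha> 1"] by (simp add: D_plus_def grid_periodic_def)

lemma grid_periodic_D_minus: "grid_periodic N f \<Longrightarrow> grid_periodic N (D_minus dx \<alpha> f)"
  using grid_periodic_shift_minus[of N f "axis \<alpha> 1"] by (simp add: D_minus_def grid_periodic_def)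

lemma grid_periodic_grad: "grid_periodic N f \<Longrightarrow> grid_periodic N (grad_h dx f)"
  using grid_periodic_D_plus[of N f dx] by (simp add: grad_h_def grid_periodic_def)

lemma grid_periodic_component: "grid_periodic N v \<Longrightarrow> grid_periodic N (\<lambda>i. v i $ \<alpha>)"
  by (simp add: grid_periodic_def)

lemma grid_periodic_div: 
  assumes "grid_periodic N v" shows "grid_periodic N (div_h dx v)"
  using grid_periodic_D_minus[OF grid_periodic_component[OF assms], of dx]
  by (simp add: div_h_def grid_periodic_def)

lemma grid_periodic_lap: "grid_periodic N f \<Longrightarrow> grid_periodic N (lap_h dx f)"
  by (simp add: lap_h_def grid_periodic_grad grid_periodic_div)

lemma grid_periodic_vlap: 
  assumes "grid_periodic N v" shows "grid_periodic N (vlap_h dx v)"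
  using grid_periodic_lap[OF grid_periodic_component[OF assms], of dx]
  by (simp add: vlap_h_def grid_periodic_def)

lemma summation_by_parts:
  assumes "grid_periodic N f" "grid_periodic N g" "N > 0"
  shows "(\<Sum>j\<in>grid_cell N. f j * D_plus dx \<alpha> g j) = - (\<Sum>j\<in>grid_cell N. D_minus dx \<alpha> f j * g j)"
proof -
  have "grid_periodic N (\<lambda>j. f (j - axis \<alpha> 1) * g j)"
    using grid_periodic_shift_minus[OF assms(1)] assms(2) by (simp add: grid_periodic_def)
  from sum_cell_shift[OF this \<open>N > 0\<close>, of \<alpha>]
  have "(\<Sum>j\<in>grid_cell N. f j * g (j + axis \<alpha> 1)) = (\<Sum>j\<in>grid_cell N. f (j - axis \<alpha> 1) * g j)"
    by simp
  then show ?thesis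
    by (simp add: D_plus_def D_minus_def right_diff_distrib left_diff_distrib sum_subtractf
        diff_divide_distrib flip: sum_divide_distrib)
qed

lemma sum_grad_h:
  assumes "grid_periodic N v" "grid_periodic N g" "N > 0"
  shows "(\<Sum>j\<in>grid_cell N. v j \<bullet> grad_h dx g j) = - (\<Sum>j\<in>grid_cell N. div_h dx v j * g j)"
proof -
  have "(\<Sum>j\<in>grid_cell N. v j \<bullet> grad_h dx g j)
    = (\<Sum>\<alpha>\<in>UNIV. \<Sum>j\<in>grid_cell N. v j $ \<alpha> * D_plus dx \<alpha> g j)"
    by (simp add: inner_vec_def grad_h_def sum.swap[of _ UNIV])
  also have "\<dots> = (\<Sum>\<alpha>\<in>UNIV. - (\<Sum>j\<in>grid_cell N. D_minus dx \<alpha> (\<lambda>i. v i $ \<alpha>) j * g j))"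
    by (simp add: summation_by_parts[OF grid_periodic_component[OF assms(1)] assms(2,3)])
  also have "\<dots> = - (\<Sum>j\<in>grid_cell N. div_h dx v j * g j)"
    by (simp add: div_h_def sum_distrib_right sum_negf sum.swap[of _ UNIV])
  finally show ?thesis .
qed

lemma lap_h_nonpos:
  assumes "grid_periodic N f" "N > 0"
  shows "(\<Sum>j\<in>grid_cell N. f j * lap_h dx f j) \<le> 0"
proof -
  have "(\<Sum>j\<in>grid_cell N. f j * lap_h dx f j) = - (\<Sum>j\<in>grid_cell N. grad_h dx f j \<bullet> grad_h dx f j)"
    using sum_grad_h[OF grid_periodic_grad[OF assms(1)] assms, of dx dx] by (simp add: lap_h_def mult.commute)
  then show ?thesis by (simp add: sum_nonneg)
qed

lemma vlap_h_nonpos: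
  assumes "grid_periodic N v" "N > 0"
  shows "(\<Sum>j\<in>grid_cell N. v j \<bullet> vlap_h dx v j) \<le> 0"
proof -
  have "(\<Sum>j\<in>grid_cell N. v j \<bullet> vlap_h dx v j)
    = (\<Sum>\<alpha>\<in>UNIV. \<Sum>j\<in>grid_cell N. v j $ \<alpha> * lap_h dx (\<lambda>i. v i $ \<alpha>) j)"
    by (simp add: inner_vec_def vlap_h_def sum.swap[of _ UNIV])
  also have "\<dots> \<le> 0"
    by (intro sum_nonpos lap_h_nonpos grid_periodic_component assms)
  finally show ?thesis .
qed

text \<open>The operator on the left of the limit flux equation; \<open>m\<close> stands for the mobility \<open>M(u)\<close>.\<close>

definition flux_op ::
  "model \<Rightarrow> real \<Rightarrow> (int^'d::finite \<Rightarrow> real) \<Rightarrow> (int^'d \<Rightarrow> real^'d) \<Rightarrow> int^'d \<Rightarrow> real^'d" where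
  "flux_op P dx m q j = (1 / m j) *\<^sub>R q j - (cq P * dx) *\<^sub>R vlap_h dx q j
     + (cw P * dx) *\<^sub>R grad_h dx (lap_h dx (div_h dx q)) j"

text \<open>Two summations by parts turn \<open>\<langle>\<^bold>q, grad\<^sub>h \<Delta>\<^sub>h div\<^sub>h \<^bold>q\<rangle>\<close> into the squared norm of
  \<open>grad\<^sub>h div\<^sub>h \<^bold>q\<close>, so that this term has the same good sign as \<open>- \<langle>\<^bold>q, \<Delta>\<^sub>h \<^bold>q\<rangle>\<close>.\<close>

lemma flux_op_coercive:
  assumes "grid_periodic N q" "N > 0" "dx > 0" "cq P > 0" "cw P > 0"
  shows "(\<Sum>j\<in>grid_cell N. (norm (q j))\<^sup>2 / m j) \<le> (\<Sum>j\<in>grid_cell N. q j \<bullet> flux_op P dx m q j)"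
proof -
  let ?S = "\<lambda>g. \<Sum>j\<in>grid_cell N. g j"
  have "?S (\<lambda>j. q j \<bullet> flux_op P dx m q j) = ?S (\<lambda>j. (norm (q j))\<^sup>2 / m j)
      - cq P * dx * ?S (\<lambda>j. q j \<bullet> vlap_h dx q j)
      + cw P * dx * ?S (\<lambda>j. q j \<bullet> grad_h dx (lap_h dx (div_h dx q)) j)"
    by (simp add: flux_op_def inner_add_right inner_diff_right sum.distrib sum_subtractf
        sum_distrib_left dot_square_norm)
  moreover have "?S (\<lambda>j. q j \<bullet> vlap_h dx q j) \<le> 0"
    by (rule vlap_h_nonpos[OF assms(1,2)])
  moreover have "?S (\<lambda>j. q j \<bullet> grad_h dx (lap_h dx (div_h dx q)) j) \<ge> 0"
    using lap_h_nonpos[OF grid_periodic_div[OF assms(1)] assms(2), of dx dx]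
    by (simp add: sum_grad_h[OF assms(1) grid_periodic_lap[OF grid_periodic_div[OF assms(1)]] assms(2)])
  ultimately show ?thesis using assms(3-5)
    by (smt (verit) mult_nonneg_nonneg mult_nonneg_nonpos mult_pos_pos)
qed

text \<open>Coercivity with the right-hand side absorbed by Young's inequality. The constant depends
  neither on \<open>N\<close> nor on \<open>dx\<close>, which is what the consistency proof needs.\<close>

lemma flux_op_stable:
  assumes "grid_periodic N q" "N > 0" "dx > 0" "cq P > 0" "cw P > 0"
    and "c > 0" and c: "\<And>j. j \<in> grid_cell N \<Longrightarrow> c \<le> 1 / m j"
  shows "(\<Sum>j\<in>grid_cell N. (norm (q j))\<^sup>2) \<le> (\<Sum>j\<in>grid_cell N. (norm (flux_op P dx m q j))\<^sup>2) / c\<^sup>2"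
proof -
  let ?S = "\<lambda>g. \<Sum>j\<in>grid_cell N. g j" and ?f = "flux_op P dx m q"
  have "c * ?S (\<lambda>j. (norm (q j))\<^sup>2) \<le> ?S (\<lambda>j. (norm (q j))\<^sup>2 / m j)"
    unfolding sum_distrib_left using c
    by (intro sum_mono) (metis mult_right_mono times_divide_eq_left mult_1 zero_le_power2)
  also have "\<dots> \<le> ?S (\<lambda>j. q j \<bullet> ?f j)"
    by (rule flux_op_coercive[OF assms(1-5)])
  also have "\<dots> \<le> ?S (\<lambda>j. c / 2 * (norm (q j))\<^sup>2 + (norm (?f j))\<^sup>2 / (2 * c))"
  proof (rule sum_mono)
    fix j
    have "0 \<le> (norm (c *\<^sub>R q j - ?f j))\<^sup>2" by simp
    also have "\<dots> = c\<^sup>2 * (norm (q j))\<^sup>2 - 2 * c * (q j \<bullet> ?f j) + (norm (?f j))\<^sup>2"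
      unfolding power2_norm_eq_inner
      by (simp add: inner_diff_left inner_diff_right inner_commute power2_eq_square)
    finally show "q j \<bullet> ?f j \<le> c / 2 * (norm (q j))\<^sup>2 + (norm (?f j))\<^sup>2 / (2 * c)"
      using \<open>c > 0\<close> by (simp add: field_simps power2_eq_square)
  qed
  also have "\<dots> = c / 2 * ?S (\<lambda>j. (norm (q j))\<^sup>2) + ?S (\<lambda>j. (norm (?f j))\<^sup>2) / (2 * c)"
    by (simp add: sum.distrib sum_distrib_left sum_divide_distrib)
  finally show ?thesis using \<open>c > 0\<close> by (simp add: field_simps power2_eq_square)
qed

lemma flux_op_injective:
  assumes "grid_periodic N q" "N > 0" "dx > 0" "cq P > 0" "cw P > 0" "\<And>j. m j > 0"
    and zero: "\<And>j. flux_op P dx m q j = 0"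
  shows "q j = 0"
proof -
  let ?C = "(\<lambda>j. 1 / m j) ` (grid_cell N :: (int^'a) set)"
  have ne: "?C \<noteq> {}" using wrap_in_cell[OF \<open>N > 0\<close>] by blast
  have fin: "finite ?C" by (simp add: finite_grid_cell)
  have "Min ?C > 0" using Min_in[OF fin ne] assms(6) by auto
  moreover have "Min ?C \<le> 1 / m j" if "j \<in> grid_cell N" for j
    using that fin by (intro Min_le) auto
  ultimately have "(\<Sum>j\<in>grid_cell N. (norm (q j))\<^sup>2) \<le> 0"
    using flux_op_stable[OF assms(1-5), of "Min ?C" m] by (simp add: zero)
  then have "(\<Sum>j\<in>grid_cell N. (norm (q j))\<^sup>2) = 0" by (smt (verit) sum_nonneg zero_le_power2)
  then have "\<forall>j\<in>grid_cell N. q j = 0"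
    by (subst (asm) sum_nonneg_eq_0_iff) (auto simp: finite_grid_cell)
  then show ?thesis using grid_periodic_wrap[OF assms(1)] wrap_in_cell[OF \<open>N > 0\<close>] by metis
qed

section \<open>Solvability of the limit flux equation\<close>

text \<open>Gaussian elimination. Applied to the system \<open>A x = \<lambda> b\<close> in the unknowns \<open>x\<close> and \<open>\<lambda>\<close>, it shows that
  an injective square system is solvable without setting up a vector space whose dimension depends
  on \<open>N\<close>.\<close>

lemma underdetermined_system:
  fixes a :: "'e \<Rightarrow> 'x \<Rightarrow> 'k::field"
  assumes "finite E" "finite X" "card E < card X"
  shows "\<exists>c. (\<exists>k\<in>X. c k \<noteq> 0) \<and> (\<forall>e\<in>E. (\<Sum>k\<in>X. a e k * c k) = 0)"
  using assms
proof (induction E arbitrary: X a rule: finite_induct)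
  case empty
  then show ?case by (intro exI[of _ "\<lambda>_. 1"]) (auto simp: card_gt_0_iff)
next
  case (insert e E)
  show ?case
  proof (cases "\<forall>k\<in>X. a e k = 0")
    case True
    have "card E < card X" using insert by simp
    with insert.IH[OF \<open>finite X\<close>, of a] True show ?thesis by auto
  next
    case False
    then obtain p where p: "p \<in> X" "a e p \<noteq> 0" by blast
    define X' where "X' = X - {p}"
    have X: "X = insert p X'" "p \<notin> X'" "finite X'" using p insert.prems by (auto simp: X'_def)
    have "card E < card X'" using insert.prems insert.hyps X by simp
    from insert.IH[OF \<open>finite X'\<close> this, of "\<lambda>f k. a f k - a f p * a e k / a e p"]
    obtain c where c: "\<exists>k\<in>X'. c k \<noteq> 0"
      "\<And>f. f \<in> E \<Longrightarrow> (\<Sum>k\<in>X'. (a f k - a f p * a e k / a e p) * c k) = 0" by blast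
    define s where "s = (\<Sum>k\<in>X'. a e k * c k)"
    define c' where "c' = c(p := - s / a e p)"
    have tot: "(\<Sum>k\<in>X. a f k * c' k) = (\<Sum>k\<in>X'. a f k * c k) - a f p * s / a e p" for f
    proof -
      have "(\<Sum>k\<in>X'. a f k * c' k) = (\<Sum>k\<in>X'. a f k * c k)"
        using X(2) by (intro sum.cong) (auto simp: c'_def)
      then show ?thesis using X by (simp add: c'_def)
    qed
    have "(\<Sum>k\<in>X'. (a f k - a f p * a e k / a e p) * c k) = (\<Sum>k\<in>X'. a f k * c k) - a f p * s / a e p" for f
      by (simp add: left_diff_distrib sum_subtractf s_def sum_distrib_left sum_divide_distrib mult.assoc)
    with c(2) tot have "\<forall>f\<in>E. (\<Sum>k\<in>X. a f k * c' k) = 0" by metis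
    moreover have "(\<Sum>k\<in>X. a e k * c' k) = 0" using p by (simp add: tot s_def)
    moreover have "\<exists>k\<in>X. c' k \<noteq> 0" using c(1) X by (auto simp: c'_def)
    ultimately show ?thesis by blast
  qed
qed

lemma D_plus_linear: "D_plus dx \<alpha> (\<lambda>j. c * f j + g j) = (\<lambda>j. c * D_plus dx \<alpha> f j + D_plus dx \<alpha> g j)"
  by (auto simp: D_plus_def fun_eq_iff add_divide_distrib diff_divide_distrib algebra_simps)

lemma D_minus_linear: "D_minus dx \<alpha> (\<lambda>j. c * f j + g j) = (\<lambda>j. c * D_minus dx \<alpha> f j + D_minus dx \<alpha> g j)"
  by (auto simp: D_minus_def fun_eq_iff add_divide_distrib diff_divide_distrib algebra_simps)

lemma grad_h_linear: "grad_h dx (\<lambda>j. c * f j + g j) = (\<lambda>j. c *\<^sub>R grad_h dx f j + grad_h dx g j)"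
  by (auto simp: grad_h_def D_plus_linear vec_eq_iff)

lemma div_h_linear: "div_h dx (\<lambda>j. c *\<^sub>R f j + g j) = (\<lambda>j. c * div_h dx f j + div_h dx g j)"
  by (auto simp: div_h_def D_minus_linear sum.distrib sum_distrib_left)

lemma lap_h_linear: "lap_h dx (\<lambda>j. c * f j + g j) = (\<lambda>j. c * lap_h dx f j + lap_h dx g j)"
  by (simp add: lap_h_def grad_h_linear div_h_linear)

lemma vlap_h_linear: "vlap_h dx (\<lambda>j. c *\<^sub>R f j + g j) = (\<lambda>j. c *\<^sub>R vlap_h dx f j + vlap_h dx g j)"
  by (auto simp: vlap_h_def lap_h_linear vec_eq_iff)

lemma flux_op_linear:
  "flux_op P dx m (\<lambda>j. c *\<^sub>R f j + g j) = (\<lambda>j. c *\<^sub>R flux_op P dx m f j + flux_op P dx m g j)"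
  unfolding flux_op_def vlap_h_linear div_h_linear lap_h_linear grad_h_linear
  by (simp add: fun_eq_iff algebra_simps)

lemma flux_op_zero: "flux_op P dx m (\<lambda>j. 0) = (\<lambda>j. 0)"
  using flux_op_linear[of P dx m "-1" "\<lambda>j. 0" "\<lambda>j. 0"] by simp

lemma flux_op_sum:
  "finite S \<Longrightarrow> flux_op P dx m (\<lambda>j. \<Sum>k\<in>S. c k *\<^sub>R f k j) = (\<lambda>j. \<Sum>k\<in>S. c k *\<^sub>R flux_op P dx m (f k) j)"
  by (induction S rule: finite_induct) (simp_all add: flux_op_zero flux_op_linear)

lemma grid_periodic_flux_op:
  assumes "grid_periodic N m" "grid_periodic N q"
  shows "grid_periodic N (flux_op P dx m q)"
  using assms(1,2) grid_periodic_vlap[OF assms(2), of dx]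
    grid_periodic_grad[OF grid_periodic_lap[OF grid_periodic_div[OF assms(2)]], of dx dx dx]
  by (simp add: flux_op_def grid_periodic_def)

text \<open>The unknowns are the values of \<open>\<^bold>q\<close> on one cell and the factor \<open>\<lambda>\<close> of the right-hand side, indexed
  by \<open>None\<close>. A nontrivial solution has \<open>\<lambda> \<noteq> 0\<close> by injectivity, and dividing by \<open>\<lambda>\<close> solves the
  equation.\<close>

lemma flux_op_surjective:
  fixes G :: "int^'d::finite \<Rightarrow> real^'d"
  assumes "N > 0" "dx > 0" "cq P > 0" "cw P > 0" "\<And>j. m j > 0"
    and m: "grid_periodic N m" and G: "grid_periodic N G"
  shows "\<exists>q. grid_periodic N q \<and> flux_op P dx m q = G"
proof -
  define J :: "((int^'d) \<times> 'd) set" where "J = grid_cell N \<times> UNIV"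
  define e :: "(int^'d) \<times> 'd \<Rightarrow> int^'d \<Rightarrow> real^'d"
    where "e k j = (if wrap N j = fst k then axis (snd k) 1 else 0)" for k j
  have finJ: "finite J" by (simp add: J_def finite_grid_cell)
  have per_wrap: "wrap N (j + axis \<alpha> (int N)) = wrap N j" for j :: "int^'d" and \<alpha>
    by (simp add: wrap_def vec_eq_iff axis_def)
  define a :: "(int^'d) \<times> 'd \<Rightarrow> ((int^'d) \<times> 'd) option \<Rightarrow> real"
    where "a i k = (case k of None \<Rightarrow> - G (fst i) $ snd i | Some k \<Rightarrow> flux_op P dx m (e k) (fst i) $ snd i)" for i k
  have "card J < card (insert None (Some ` J))"
    using finJ by (simp add: card_image)
  from underdetermined_system[OF finJ _ this, of a] finJ
  obtain c where nz: "\<exists>k\<in>insert None (Some ` J). c k \<noteq> 0"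
    and c: "\<And>i. i \<in> J \<Longrightarrow> (\<Sum>k\<in>insert None (Some ` J). a i k * c k) = 0" by auto
  define q where "q j = (\<Sum>k\<in>J. c (Some k) *\<^sub>R e k j)" for j
  have q_per: "grid_periodic N q" by (simp add: grid_periodic_def q_def e_def per_wrap)
  have q_coeff: "q j $ \<alpha> = c (Some (j, \<alpha>))" if "j \<in> grid_cell N" for j \<alpha>
  proof -
    have "q j $ \<alpha> = (\<Sum>k\<in>J. if k = (j, \<alpha>) then c (Some k) else 0)"
      unfolding q_def using that
      by (auto simp: e_def wrap_cell_id axis_def intro!: sum.cong)
    also have "\<dots> = c (Some (j, \<alpha>))" using that finJ by (simp add: J_def)
    finally show ?thesis .
  qed
  have op: "flux_op P dx m q j = c None *\<^sub>R G j" for j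
  proof -
    have "flux_op P dx m q i $ \<alpha> = c None * G i $ \<alpha>" if "i \<in> grid_cell N" for i \<alpha>
    proof -
      have "(\<Sum>k\<in>insert None (Some ` J). a (i, \<alpha>) k * c k) = 0" using c that by (simp add: J_def)
      then have "(\<Sum>k\<in>J. c (Some k) * flux_op P dx m (e k) i $ \<alpha>) = c None * G i $ \<alpha>"
        using finJ by (simp add: a_def sum.reindex mult.commute)
      then show ?thesis unfolding q_def by (simp add: flux_op_sum[OF finJ])
    qed
    then have "flux_op P dx m q = (\<lambda>j. c None *\<^sub>R G j)"
      using grid_periodic_eqI[OF grid_periodic_flux_op[OF m q_per] _ \<open>N > 0\<close>] G
      by (simp add: grid_periodic_def vec_eq_iff)
    then show ?thesis by simp
  qed
  have c0: "c None \<noteq> 0"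
  proof
    assume "c None = 0"
    then have "q j = 0" for j
      using flux_op_injective[where m = m, OF q_per assms(1-5)] op by simp
    then have "c (Some k) = 0" if "k \<in> J" for k
      using that q_coeff[of "fst k" "snd k"] by (auto simp: J_def)
    with nz \<open>c None = 0\<close> show False by auto
  qed
  have "flux_op P dx m (\<lambda>j. (1 / c None) *\<^sub>R q j) = G"
    using flux_op_linear[of P dx m "1 / c None" q "\<lambda>j. 0"] c0 by (simp add: op flux_op_zero)
  moreover have "grid_periodic N (\<lambda>j. (1 / c None) *\<^sub>R q j)" using q_per by (simp add: grid_periodic_def)
  ultimately show ?thesis by blast
qed

lemma flux_op_unique:
  assumes "N > 0" "dx > 0" "cq P > 0" "cw P > 0" "\<And>j. m j > 0"
    and "grid_periodic N q" "grid_periodic N q'" and "flux_op P dx m q = flux_op P dx m q'"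
  shows "q = q'"
proof
  fix j
  have "grid_periodic N (\<lambda>j. (- 1) *\<^sub>R q j + q' j)" using assms(6,7) by (simp add: grid_periodic_def)
  from flux_op_injective[where m = m, OF this assms(1-5)] have "(- 1) *\<^sub>R q j + q' j = 0"
    using flux_op_linear[of P dx m "-1" q q'] assms(8) by simp
  then show "q j = q' j" by simp
qed

definition flux :: "model \<Rightarrow> real \<Rightarrow> nat \<Rightarrow> (int^'d::finite \<Rightarrow> real) \<Rightarrow> int^'d \<Rightarrow> real^'d" where
  "flux P dx N u = (THE q. grid_periodic N q \<and>
     flux_op P dx (\<lambda>j. mob P (u j)) q = grad_h dx (\<lambda>j. gam P * lap_h dx u j - pot P (u j)))"

lemma flux_solves:
  assumes "standing_assumptions P" "N > 0" "dx > 0" "grid_periodic N u"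
  shows "grid_periodic N (flux P dx N u)"
    and "flux_op P dx (\<lambda>j. mob P (u j)) (flux P dx N u)
       = grad_h dx (\<lambda>j. gam P * lap_h dx u j - pot P (u j))"
    and flux_eqI: "\<And>q. grid_periodic N q \<Longrightarrow> flux_op P dx (\<lambda>j. mob P (u j)) q
       = grad_h dx (\<lambda>j. gam P * lap_h dx u j - pot P (u j)) \<Longrightarrow> q = flux P dx N u"
proof -
  let ?p = "\<lambda>q. grid_periodic N q \<and>
     flux_op P dx (\<lambda>j. mob P (u j)) q = grad_h dx (\<lambda>j. gam P * lap_h dx u j - pot P (u j))"
  have pos: "cq P > 0" "cw P > 0" "\<And>j. mob P (u j) > 0"
    using assms(1) by (auto simp: standing_assumptions_def)
  have "grid_periodic N (grad_h dx (\<lambda>j. gam P * lap_h dx u j - pot P (u j)))"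
    using grid_periodic_lap[OF assms(4), of dx] assms(4)
    by (intro grid_periodic_grad) (simp add: grid_periodic_def)
  moreover have "grid_periodic N (\<lambda>j. mob P (u j))" using assms(4) by (simp add: grid_periodic_def)
  ultimately have "\<exists>q. ?p q" using flux_op_surjective[where m = "\<lambda>j. mob P (u j)", OF assms(2,3) pos] by blast
  moreover have un: "q = q'" if "?p q" "?p q'" for q q'
    using flux_op_unique[where m = "\<lambda>j. mob P (u j)", OF assms(2,3) pos, of q q'] that by simp
  ultimately have "\<exists>!q. ?p q" by blast
  from theI'[OF this] have fl: "?p (flux P dx N u)" unfolding flux_def .
  then show "grid_periodic N (flux P dx N u)"
    "flux_op P dx (\<lambda>j. mob P (u j)) (flux P dx N u)
       = grad_h dx (\<lambda>j. gam P * lap_h dx u j - pot P (u j))" by blast+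
  show "q = flux P dx N u" if "grid_periodic N q" "flux_op P dx (\<lambda>j. mob P (u j)) q
       = grad_h dx (\<lambda>j. gam P * lap_h dx u j - pot P (u j))" for q
    using un fl that by blast
qed

section \<open>Families of functions with uniformly bounded derivatives\<close>

lemma axis_add: "axis \<alpha> (s + t) = axis \<alpha> s + (axis \<alpha> t :: ('a::monoid_add)^'d)"
  by (simp add: vec_eq_iff axis_def)

lemma scaleR_axis_1: "s *\<^sub>R axis \<alpha> 1 = (axis \<alpha> s :: real^'d)"
  by (simp add: vec_eq_iff axis_def)

lemma axis_zero: "axis \<alpha> 0 = (0 :: ('a::zero)^'d)"
  by (simp add: vec_eq_iff axis_def)

text \<open>A family is indexed by \<open>i \<in> I\<close>; in the application \<open>i\<close> is a pair of a grid size and a time. All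
  bounds are uniform in \<open>i\<close>.\<close>

definition has_partial ::
  "'i set \<Rightarrow> 'd \<Rightarrow> ('i \<Rightarrow> real^'d::finite \<Rightarrow> real) \<Rightarrow> ('i \<Rightarrow> real^'d \<Rightarrow> real) \<Rightarrow> bool" where
  "has_partial I \<alpha> F G \<longleftrightarrow>
     (\<forall>i\<in>I. \<forall>x. ((\<lambda>s. F i (x + axis \<alpha> s)) has_real_derivative G i x) (at 0))"

definition bounded_periodic :: "'i set \<Rightarrow> real \<Rightarrow> ('i \<Rightarrow> real^'d::finite \<Rightarrow> real) \<Rightarrow> bool" where
  "bounded_periodic I L F \<longleftrightarrow> (\<exists>B. \<forall>i\<in>I. \<forall>x. \<bar>F i x\<bar> \<le> B) \<and>
     (\<forall>i\<in>I. \<forall>x \<alpha>. F i (x + axis \<alpha> L) = F i x)"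

text \<open>Existence of the partial derivatives is part
  of the condition, so that no derivative operator with arbitrary values enters the
  induction.\<close>

primrec bounded_partials :: "nat \<Rightarrow> 'i set \<Rightarrow> real \<Rightarrow> ('i \<Rightarrow> real^'d::finite \<Rightarrow> real) \<Rightarrow> bool" where
  "bounded_partials 0 I L F \<longleftrightarrow> bounded_periodic I L F"
| "bounded_partials (Suc k) I L F \<longleftrightarrow> bounded_periodic I L F \<and>
     (\<forall>\<alpha>. \<exists>G. has_partial I \<alpha> F G \<and> bounded_partials k I L G)"

definition smooth_family :: "'i set \<Rightarrow> real \<Rightarrow> ('i \<Rightarrow> real^'d::finite \<Rightarrow> real) \<Rightarrow> bool" where
  "smooth_family I L F \<longleftrightarrow> (\<forall>k. bounded_partials k I L F)"

lemma has_partial_at: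
  assumes "has_partial I \<alpha> F G" "i \<in> I"
  shows "((\<lambda>s. F i (x + axis \<alpha> s)) has_real_derivative G i (x + axis \<alpha> s)) (at s)"
proof -
  have "((\<lambda>t. F i (x + axis \<alpha> s + axis \<alpha> t)) has_real_derivative G i (x + axis \<alpha> s)) (at 0)"
    using assms by (auto simp: has_partial_def)
  then have "((\<lambda>t. F i (x + axis \<alpha> (t + s))) has_real_derivative G i (x + axis \<alpha> s)) (at 0)"
    by (simp add: axis_add ac_simps)
  then show ?thesis
    unfolding DERIV_shift[of "\<lambda>s. F i (x + axis \<alpha> s)" "G i (x + axis \<alpha> s)" 0 s, symmetric, simplified] .
qed

lemma has_partial_unique:
  "has_partial I \<alpha> F G \<Longrightarrow> has_partial I \<alpha> F G' \<Longrightarrow> i \<in> I \<Longrightarrow> G i = G' i"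
  unfolding has_partial_def by (intro ext) (blast intro: DERIV_unique)

lemma bounded_periodic_cong:
  "(\<And>i. i \<in> I \<Longrightarrow> F i = G i) \<Longrightarrow> bounded_periodic I L F = bounded_periodic I L G"
  by (simp add: bounded_periodic_def cong: ball_cong)

lemma has_partial_cong:
  "(\<And>i. i \<in> I \<Longrightarrow> F i = G i) \<Longrightarrow> has_partial I \<alpha> F = has_partial I \<alpha> G"
  by (simp add: has_partial_def fun_eq_iff cong: ball_cong)

lemma bounded_partials_cong:
  "(\<And>i. i \<in> I \<Longrightarrow> F i = G i) \<Longrightarrow> bounded_partials k I L F = bounded_partials k I L G"
  by (cases k) (simp_all add: bounded_periodic_cong[of I F G] has_partial_cong[of I F G])

lemma smooth_family_cong:
  "(\<And>i. i \<in> I \<Longrightarrow> F i = G i) \<Longrightarrow> smooth_family I L F \<Longrightarrow> smooth_family I L G"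
  using bounded_partials_cong[of I F G] by (simp add: smooth_family_def)

lemma bounded_partials_SucD: "bounded_partials (Suc k) I L F \<Longrightarrow> bounded_partials k I L F"
  by (induction k arbitrary: F) (simp, metis bounded_partials.simps(2))

lemma smooth_family_bounded_periodic: "smooth_family I L F \<Longrightarrow> bounded_periodic I L F"
  unfolding smooth_family_def by (metis bounded_partials.simps(1))

lemma smooth_family_bound:
  assumes "smooth_family I L F"
  obtains B where "B > 0" "\<And>i x. i \<in> I \<Longrightarrow> \<bar>F i x\<bar> \<le> B"
proof -
  obtain B where "\<forall>i\<in>I. \<forall>x. \<bar>F i x\<bar> \<le> B"
    using smooth_family_bounded_periodic[OF assms] by (auto simp: bounded_periodic_def)
  then show thesis by (intro that[of "max B 1"]) (auto intro: max.coboundedI1)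
qed

lemma smooth_family_periodic:
  "smooth_family I L F \<Longrightarrow> i \<in> I \<Longrightarrow> F i (x + axis \<alpha> L) = F i x"
  using smooth_family_bounded_periodic[of I L F] by (auto simp: bounded_periodic_def)

lemma smooth_family_partial:
  assumes "smooth_family I L F" "has_partial I \<alpha> F G"
  shows "smooth_family I L G"
  unfolding smooth_family_def
proof
  fix k
  have "bounded_partials (Suc k) I L F" using assms(1) by (auto simp: smooth_family_def)
  then obtain G' where G': "has_partial I \<alpha> F G'" "bounded_partials k I L G'" by auto
  then show "bounded_partials k I L G"
    using bounded_partials_cong[of I G G'] has_partial_unique[OF assms(2) G'(1)] by blast
qed

lemma smooth_family_partialE:
  assumes "smooth_family I L F"
  obtains G where "has_partial I \<alpha> F G" "smooth_family I L G"
proof -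
  have "bounded_partials (Suc 0) I L F" using assms by (simp only: smooth_family_def)
  then obtain G where "has_partial I \<alpha> F G" by auto
  then show thesis using that smooth_family_partial[OF assms] by blast
qed

text \<open>Replaces the induction on the order of the derivatives whenever the families at hand form a class closed
  under taking one partial derivative.\<close>

lemma smooth_family_coinduct:
  assumes "Q F"
    and basic: "\<And>F. Q F \<Longrightarrow> bounded_periodic I L F"
    and step: "\<And>F \<alpha>. Q F \<Longrightarrow> \<exists>G. has_partial I \<alpha> F G \<and> Q G"
  shows "smooth_family I L F"
  unfolding smooth_family_def
proof
  fix k show "bounded_partials k I L F" using \<open>Q F\<close>
  proof (induction k arbitrary: F)
    case (Suc k)
    then show ?case using basic step by (metis bounded_partials.simps(2))
  qed (simp add: basic)
qed

lemma smooth_family_pderiv: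
  assumes "smooth_family I L F"
  shows "has_partial I \<alpha> F (\<lambda>i. pderiv_at \<alpha> (F i))" and "smooth_family I L (\<lambda>i. pderiv_at \<alpha> (F i))"
proof -
  obtain G where G: "has_partial I \<alpha> F G" by (rule smooth_family_partialE[OF assms])
  then have "G i = pderiv_at \<alpha> (F i)" if "i \<in> I" for i
    using that by (intro ext) (simp add: has_partial_def pderiv_at_def scaleR_axis_1 DERIV_imp_deriv[symmetric])
  with G show *: "has_partial I \<alpha> F (\<lambda>i. pderiv_at \<alpha> (F i))" by (simp add: has_partial_def)
  show "smooth_family I L (\<lambda>i. pderiv_at \<alpha> (F i))" by (rule smooth_family_partial[OF assms *])
qed

lemma bounded_partials_add:
  assumes "bounded_partials k I L F" "bounded_partials k I L G"
  shows "bounded_partials k I L (\<lambda>i x. F i x + G i x)"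
  using assms
proof (induction k arbitrary: F G)
  have basic: "bounded_periodic I L (\<lambda>i x. F i x + G i x)"
    if FG: "bounded_periodic I L F" "bounded_periodic I L G" for F G :: "'a \<Rightarrow> real^'b \<Rightarrow> real"
  proof -
    obtain B C where "\<forall>i\<in>I. \<forall>x. \<bar>F i x\<bar> \<le> B" "\<forall>i\<in>I. \<forall>x. \<bar>G i x\<bar> \<le> C"
      using FG by (auto simp: bounded_periodic_def)
    then have "\<forall>i\<in>I. \<forall>x. \<bar>F i x + G i x\<bar> \<le> B + C"
      by (meson abs_triangle_ineq add_mono order_trans)
    then show ?thesis using FG by (auto simp: bounded_periodic_def)
  qed
  {
    case 0
    then show ?case by (simp add: basic)
  next
    case (Suc k)
    have "\<exists>H. has_partial I \<alpha> (\<lambda>i x. F i x + G i x) H \<and> bounded_partials k I L H" for \<alpha>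
    proof -
      obtain F' G' where "has_partial I \<alpha> F F'" "bounded_partials k I L F'"
        "has_partial I \<alpha> G G'" "bounded_partials k I L G'" using Suc.prems by (meson bounded_partials.simps(2))
      then show ?thesis
        by (intro exI[of _ "\<lambda>i x. F' i x + G' i x"]) (auto simp: has_partial_def Suc.IH intro!: DERIV_add)
    qed
    with Suc.prems show ?case by (simp add: basic)
  }
qed

lemma bounded_partials_mult:
  assumes "bounded_partials k I L F" "bounded_partials k I L G"
  shows "bounded_partials k I L (\<lambda>i x. F i x * G i x)"
  using assms
proof (induction k arbitrary: F G)
  have basic: "bounded_periodic I L (\<lambda>i x. F i x * G i x)"
    if FG: "bounded_periodic I L F" "bounded_periodic I L G" for F G :: "'a \<Rightarrow> real^'b \<Rightarrow> real"
  proof -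
    obtain B C where "\<forall>i\<in>I. \<forall>x. \<bar>F i x\<bar> \<le> B" "\<forall>i\<in>I. \<forall>x. \<bar>G i x\<bar> \<le> C"
      using FG by (auto simp: bounded_periodic_def)
    then have "\<forall>i\<in>I. \<forall>x. \<bar>F i x * G i x\<bar> \<le> B * C"
      unfolding abs_mult by (meson abs_ge_zero mult_mono order_trans)
    then show ?thesis using FG by (auto simp: bounded_periodic_def)
  qed
  {
    case 0
    then show ?case by (simp add: basic)
  next
    case (Suc k)
    have "\<exists>H. has_partial I \<alpha> (\<lambda>i x. F i x * G i x) H \<and> bounded_partials k I L H" for \<alpha>
    proof -
      obtain F' G' where d: "has_partial I \<alpha> F F'" "bounded_partials k I L F'"
        "has_partial I \<alpha> G G'" "bounded_partials k I L G'" using Suc.prems by (meson bounded_partials.simps(2))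
      let ?H = "\<lambda>i x. F' i x * G i x + G' i x * F i x"
      have "has_partial I \<alpha> (\<lambda>i x. F i x * G i x) ?H"
        unfolding has_partial_def
      proof (intro ballI allI)
        fix i x assume "i \<in> I"
        then show "((\<lambda>s. F i (x + axis \<alpha> s) * G i (x + axis \<alpha> s)) has_real_derivative ?H i x) (at 0)"
          using d(1,3) DERIV_mult[of "\<lambda>s. F i (x + axis \<alpha> s)" "F' i x" 0 UNIV "\<lambda>s. G i (x + axis \<alpha> s)" "G' i x"]
          by (simp add: has_partial_def axis_zero)
      qed
      moreover have "bounded_partials k I L ?H"
        using d(2,4) Suc.prems[THEN bounded_partials_SucD] by (intro bounded_partials_add Suc.IH)
      ultimately show ?thesis by blast
    qed
    with Suc.prems show ?case by (simp add: basic)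
  }
qed

lemma smooth_family_add:
  "smooth_family I L F \<Longrightarrow> smooth_family I L G \<Longrightarrow> smooth_family I L (\<lambda>i x. F i x + G i x)"
  by (simp add: smooth_family_def bounded_partials_add)

lemma smooth_family_mult:
  "smooth_family I L F \<Longrightarrow> smooth_family I L G \<Longrightarrow> smooth_family I L (\<lambda>i x. F i x * G i x)"
  by (simp add: smooth_family_def bounded_partials_mult)

lemma smooth_family_const:
  assumes "\<And>i. i \<in> I \<Longrightarrow> \<bar>c i\<bar> \<le> B"
  shows "smooth_family I L (\<lambda>i x. c i)"
proof (rule smooth_family_coinduct[where Q = "\<lambda>F. \<exists>c B. (\<forall>i\<in>I. \<bar>c i\<bar> \<le> B) \<and> F = (\<lambda>i x. c i)"])
  fix F :: "'a \<Rightarrow> real^'b \<Rightarrow> real" and \<alpha>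
  assume F: "\<exists>c B. (\<forall>i\<in>I. \<bar>c i\<bar> \<le> B) \<and> F = (\<lambda>i x. c i)"
  then show "bounded_periodic I L F" by (auto simp: bounded_periodic_def)
  show "\<exists>G. has_partial I \<alpha> F G \<and> (\<exists>c B. (\<forall>i\<in>I. \<bar>c i\<bar> \<le> B) \<and> G = (\<lambda>i x. c i))"
    using F by (intro exI[of _ "\<lambda>i x. 0"]) (auto simp: has_partial_def intro!: exI[of _ "\<lambda>i. 0"] exI[of _ 0])
qed (use assms in auto)

lemma smooth_family_cmult: "smooth_family I L F \<Longrightarrow> smooth_family I L (\<lambda>i x. c * F i x)"
  by (rule smooth_family_mult[OF smooth_family_const[where B = "\<bar>c\<bar>"]]) simp_all

lemma smooth_family_diff:
  "smooth_family I L F \<Longrightarrow> smooth_family I L G \<Longrightarrow> smooth_family I L (\<lambda>i x. F i x - G i x)"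
  using smooth_family_add[OF _ smooth_family_cmult[of I L G "-1"]] by simp

lemma smooth_family_sum:
  "finite A \<Longrightarrow> (\<And>a. a \<in> A \<Longrightarrow> smooth_family I L (F a)) \<Longrightarrow> smooth_family I L (\<lambda>i x. \<Sum>a\<in>A. F a i x)"
  by (induction A rule: finite_induct) (simp_all add: smooth_family_add smooth_family_const[where B = 0])

lemma partial_increment_le:
  assumes "has_partial I \<alpha> F G" "i \<in> I" "\<And>x. \<bar>G i x\<bar> \<le> B"
  shows "\<bar>F i (x + axis \<alpha> s) - F i x\<bar> \<le> B * \<bar>s\<bar>"
proof -
  have "norm (F i (x + axis \<alpha> s) - F i (x + axis \<alpha> 0)) \<le> B * norm (s - 0)"
    by (rule field_differentiable_bound[where S = UNIV and f = "\<lambda>s. F i (x + axis \<alpha> s)"])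
      (use assms has_partial_at in \<open>auto\<close>)
  then show ?thesis by (simp add: axis_zero)
qed

lemma partial_taylor_le:
  assumes "has_partial I \<alpha> F G" "has_partial I \<alpha> G H" "i \<in> I" "\<And>x. \<bar>H i x\<bar> \<le> B"
  shows "\<bar>F i (x + axis \<alpha> s) - F i x - s * G i x\<bar> \<le> B * s\<^sup>2"
proof -
  have B: "B \<ge> 0" using assms(4) abs_ge_zero order_trans by blast
  have "norm ((F i (x + axis \<alpha> s) - s * G i x) - (F i (x + axis \<alpha> 0) - 0 * G i x)) \<le> (B * \<bar>s\<bar>) * norm (s - 0)"
  proof (rule field_differentiable_bound[where S = "{- \<bar>s\<bar>..\<bar>s\<bar>}" and f = "\<lambda>s. F i (x + axis \<alpha> s) - s * G i x"])
    fix t assume t: "t \<in> {- \<bar>s\<bar>..\<bar>s\<bar>}"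
    show "((\<lambda>s. F i (x + axis \<alpha> s) - s * G i x) has_field_derivative G i (x + axis \<alpha> t) - G i x)
        (at t within {- \<bar>s\<bar>..\<bar>s\<bar>})"
      by (rule derivative_eq_intros has_field_derivative_at_within[OF has_partial_at[OF assms(1,3)]] refl | simp)+
    have "B * \<bar>t\<bar> \<le> B * \<bar>s\<bar>" using t B by (intro mult_left_mono) auto
    then show "norm (G i (x + axis \<alpha> t) - G i x) \<le> B * \<bar>s\<bar>"
      using partial_increment_le[OF assms(2,3,4), of x t] by simp
  qed auto
  then show ?thesis by (simp add: axis_zero power2_eq_square mult.assoc)
qed

lemma DERIV_quadratic_remainder:
  fixes f :: "real \<Rightarrow> real"
  assumes "\<And>s. \<bar>f s - f 0 - s * D\<bar> \<le> B * s\<^sup>2"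
  shows "(f has_real_derivative D) (at 0)"
proof -
  have "((\<lambda>s. (f s - f 0) / s - D) \<longlongrightarrow> 0) (at 0)"
  proof (rule Lim_null_comparison)
    have "\<bar>(f s - f 0) / s - D\<bar> \<le> B * \<bar>s\<bar>" if "s \<noteq> 0" for s
    proof -
      have "\<bar>(f s - f 0) / s - D\<bar> = \<bar>f s - f 0 - s * D\<bar> / \<bar>s\<bar>"
        using that by (simp add: diff_divide_distrib flip: abs_divide)
      also have "\<dots> \<le> B * \<bar>s\<bar>\<^sup>2 / \<bar>s\<bar>" using assms by (intro divide_right_mono) auto
      also have "\<dots> = B * \<bar>s\<bar>" using that by (simp add: power2_eq_square del: abs_mult_self_eq)
      finally show ?thesis .
    qed
    then show "\<forall>\<^sub>F s in at 0. norm ((f s - f 0) / s - D) \<le> B * \<bar>s\<bar>"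
      by (simp add: eventually_at_filter)
    show "((\<lambda>s. B * \<bar>s\<bar>) \<longlongrightarrow> 0) (at 0)" by (auto intro!: tendsto_eq_intros)
  qed
  then show ?thesis by (simp add: has_field_derivative_iff LIM_zero_iff)
qed

text \<open>Schwarz's theorem. The difference quotient of \<open>F\<close> in direction \<open>\<alpha>\<close> with step \<open>k\<close> is within
  \<open>O(k)\<close> of \<open>\<partial>\<^sub>\<alpha> F\<close>, and its derivative in direction \<open>\<beta>\<close> is within \<open>O(k)\<close> of
  \<open>\<partial>\<^sub>\<alpha> \<partial>\<^sub>\<beta> F\<close>. The mean value theorem for the difference quotient then holds for its limit as
  \<open>k\<close> tends to 0 and identifies the derivative of \<open>\<partial>\<^sub>\<alpha> F\<close> in direction \<open>\<beta>\<close>.\<close>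

lemma partials_commute:
  assumes F: "smooth_family I L F" and "i \<in> I"
    and Fa: "has_partial I \<alpha> F Fa" and Fb: "has_partial I \<beta> F Fb"
    and Fab: "has_partial I \<beta> Fa Fab" and Fba: "has_partial I \<alpha> Fb Fba"
  shows "Fab i = Fba i"
proof
  fix x
  have sFa: "smooth_family I L Fa" by (rule smooth_family_partial[OF F Fa])
  have sFb: "smooth_family I L Fb" by (rule smooth_family_partial[OF F Fb])
  have sFba: "smooth_family I L Fba" by (rule smooth_family_partial[OF sFb Fba])
  obtain Faa where Faa: "has_partial I \<alpha> Fa Faa" "smooth_family I L Faa" by (rule smooth_family_partialE[OF sFa])
  obtain Fbaa where Fbaa: "has_partial I \<alpha> Fba Fbaa" "smooth_family I L Fbaa" by (rule smooth_family_partialE[OF sFba])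
  obtain Fbab where Fbab: "has_partial I \<beta> Fba Fbab" "smooth_family I L Fbab" by (rule smooth_family_partialE[OF sFba])
  obtain A where A: "A > 0" "\<And>x. \<bar>Faa i x\<bar> \<le> A" using smooth_family_bound[OF Faa(2)] \<open>i \<in> I\<close> by metis
  obtain B where B: "B > 0" "\<And>x. \<bar>Fbaa i x\<bar> \<le> B" using smooth_family_bound[OF Fbaa(2)] \<open>i \<in> I\<close> by metis
  obtain C where C: "C > 0" "\<And>x. \<bar>Fbab i x\<bar> \<le> C" using smooth_family_bound[OF Fbab(2)] \<open>i \<in> I\<close> by metis
  have "\<bar>Fa i (x + axis \<beta> s) - Fa i x - s * Fba i x\<bar> \<le> C * s\<^sup>2 + (B * \<bar>s\<bar> + 2 * A) * k" if "k > 0" for s k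
  proof -
    define g where "g t = (F i (x + axis \<beta> t + axis \<alpha> k) - F i (x + axis \<beta> t)) / k" for t
    define g' where "g' t = (Fb i (x + axis \<beta> t + axis \<alpha> k) - Fb i (x + axis \<beta> t)) / k" for t
    have g': "(g has_real_derivative g' t) (at t)" for t
      using has_partial_at[OF Fb \<open>i \<in> I\<close>, of x t] has_partial_at[OF Fb \<open>i \<in> I\<close>, of "x + axis \<alpha> k" t]
      unfolding g_def g'_def by (intro DERIV_cdivide DERIV_diff) (simp_all add: ac_simps)
    have quot: "\<bar>(u - v) / k - w\<bar> \<le> D * k" if "\<bar>u - v - k * w\<bar> \<le> D * k\<^sup>2" for u v w D
    proof -
      have "\<bar>(u - v) / k - w\<bar> = \<bar>(u - v - k * w) / k\<bar>"
        using \<open>k > 0\<close> by (simp add: diff_divide_distrib)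
      also have "\<dots> = \<bar>u - v - k * w\<bar> / k" using \<open>k > 0\<close> by simp
      also have "\<dots> \<le> D * k\<^sup>2 / k" using that \<open>k > 0\<close> by (intro divide_right_mono) auto
      finally show ?thesis using \<open>k > 0\<close> by (simp add: power2_eq_square)
    qed
    \<comment> \<open>Both estimates are Taylor expansions with step \<open>k\<close> in direction \<open>\<alpha>\<close>.\<close>
    have gFa: "\<bar>g t - Fa i (x + axis \<beta> t)\<bar> \<le> A * k" for t
      unfolding g_def by (intro quot partial_taylor_le[OF Fa Faa(1) \<open>i \<in> I\<close> A(2)])
    have gFba: "\<bar>g' t - Fba i (x + axis \<beta> t)\<bar> \<le> B * k" for t
      unfolding g'_def by (intro quot partial_taylor_le[OF Fba Fbaa(1) \<open>i \<in> I\<close> B(2)])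
    have "norm ((g s - s * Fba i x) - (g 0 - 0 * Fba i x)) \<le> (B * k + C * \<bar>s\<bar>) * norm (s - 0)"
    proof (rule field_differentiable_bound[where S = "{- \<bar>s\<bar>..\<bar>s\<bar>}" and f = "\<lambda>s. g s - s * Fba i x"])
      fix t assume t: "t \<in> {- \<bar>s\<bar>..\<bar>s\<bar>}"
      show "((\<lambda>s. g s - s * Fba i x) has_field_derivative g' t - Fba i x) (at t within {- \<bar>s\<bar>..\<bar>s\<bar>})"
        by (rule derivative_eq_intros has_field_derivative_at_within[OF g'] refl | simp)+
      have "C * \<bar>t\<bar> \<le> C * \<bar>s\<bar>" using t C by (intro mult_left_mono) auto
      then show "norm (g' t - Fba i x) \<le> B * k + C * \<bar>s\<bar>"
        using partial_increment_le[OF Fbab(1) \<open>i \<in> I\<close> C(2), of x t] gFba[of t] by simp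
    qed auto
    moreover have "(B * k + C * \<bar>s\<bar>) * \<bar>s\<bar> = B * \<bar>s\<bar> * k + C * s\<^sup>2"
      by (simp add: power2_eq_square distrib_right mult.assoc)
    ultimately have "\<bar>g s - g 0 - s * Fba i x\<bar> \<le> B * \<bar>s\<bar> * k + C * s\<^sup>2"
      by (simp add: algebra_simps power2_eq_square)
    then show ?thesis using gFa[of s] gFa[of 0] by (simp add: axis_zero algebra_simps)
  qed
  then have lim: "\<bar>Fa i (x + axis \<beta> s) - Fa i x - s * Fba i x\<bar> \<le> C * s\<^sup>2" for s
  proof -
    assume *: "\<And>k s. 0 < k \<Longrightarrow> \<bar>Fa i (x + axis \<beta> s) - Fa i x - s * Fba i x\<bar> \<le> C * s\<^sup>2 + (B * \<bar>s\<bar> + 2 * A) * k"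
    have pos: "B * \<bar>s\<bar> + 2 * A > 0" using A B by (simp add: add_nonneg_pos)
    show ?thesis
    proof (rule field_le_epsilon)
      fix e :: real assume "e > 0"
      then show "\<bar>Fa i (x + axis \<beta> s) - Fa i x - s * Fba i x\<bar> \<le> C * s\<^sup>2 + e"
        using *[of "e / (B * \<bar>s\<bar> + 2 * A)" s] pos by simp
    qed
  qed
  have "((\<lambda>s. Fa i (x + axis \<beta> s)) has_real_derivative Fba i x) (at 0)"
    by (rule DERIV_quadratic_remainder[where B = C]) (use lim in \<open>simp add: axis_zero\<close>)
  then show "Fab i x = Fba i x"
    using Fab \<open>i \<in> I\<close> unfolding has_partial_def by (blast intro: DERIV_unique)
qed

text \<open>The step may be negative, so that forward and backward differences are both instances.\<close>

definition diff_quot ::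
  "('i \<Rightarrow> real) \<Rightarrow> 'd \<Rightarrow> ('i \<Rightarrow> real^'d::finite \<Rightarrow> real) \<Rightarrow> 'i \<Rightarrow> real^'d \<Rightarrow> real" where
  "diff_quot k \<alpha> F i x = (F i (x + axis \<alpha> (k i)) - F i x) / k i"

lemma has_partial_diff_quot:
  assumes "has_partial I \<beta> F G"
  shows "has_partial I \<beta> (diff_quot k \<alpha> F) (diff_quot k \<alpha> G)"
  unfolding has_partial_def diff_quot_def
proof (intro ballI allI DERIV_cdivide DERIV_diff)
  fix i x assume "i \<in> I"
  then have "((\<lambda>s. F i ((x + axis \<alpha> (k i)) + axis \<beta> s)) has_real_derivative G i (x + axis \<alpha> (k i))) (at 0)"
    using assms by (simp add: has_partial_def)
  then show "((\<lambda>s. F i (x + axis \<beta> s + axis \<alpha> (k i))) has_real_derivative G i (x + axis \<alpha> (k i))) (at 0)"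
    by (simp add: ac_simps)
  show "((\<lambda>s. F i (x + axis \<beta> s)) has_real_derivative G i x) (at 0)"
    using assms \<open>i \<in> I\<close> by (simp add: has_partial_def)
qed

lemma periodic_diff_quot:
  assumes "bounded_periodic I L F" "i \<in> I"
  shows "diff_quot k \<alpha> F i (x + axis \<beta> L) = diff_quot k \<alpha> F i x"
proof -
  have per: "F i (y + axis \<beta> L) = F i y" for y using assms by (simp add: bounded_periodic_def)
  have "F i (x + axis \<beta> L + axis \<alpha> (k i)) = F i (x + axis \<alpha> (k i))"
    using per[of "x + axis \<alpha> (k i)"] by (simp add: ac_simps)
  then show ?thesis by (simp add: diff_quot_def per)
qed

text \<open>Derivatives pass through difference quotients, so only the bound of the quotient itself needs the mean value theorem.\<close>

lemma smooth_family_diff_quot: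
  assumes "smooth_family I L F" "\<And>i. i \<in> I \<Longrightarrow> k i \<noteq> 0"
  shows "smooth_family I L (diff_quot k \<alpha> F)"
proof (rule smooth_family_coinduct[where Q = "\<lambda>G. \<exists>F. smooth_family I L F \<and> G = diff_quot k \<alpha> F"])
  fix G \<beta> assume "\<exists>F. smooth_family I L F \<and> G = diff_quot k \<alpha> F"
  then obtain F where F: "smooth_family I L F" "G = diff_quot k \<alpha> F" by blast
  obtain F' where F': "has_partial I \<alpha> F F'" "smooth_family I L F'" by (rule smooth_family_partialE[OF F(1)])
  obtain B where B: "\<And>i x. i \<in> I \<Longrightarrow> \<bar>F' i x\<bar> \<le> B" using smooth_family_bound[OF F'(2)] by metis
  have "\<bar>diff_quot k \<alpha> F i x\<bar> \<le> B" if "i \<in> I" for i x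
    using partial_increment_le[OF F'(1) that, of B x "k i"] B assms(2) that
    by (simp add: diff_quot_def divide_le_eq)
  then show "bounded_periodic I L G"
    using periodic_diff_quot[OF smooth_family_bounded_periodic[OF F(1)]] F(2)
    unfolding bounded_periodic_def by auto
  obtain H where "has_partial I \<beta> F H" "smooth_family I L H" by (rule smooth_family_partialE[OF F(1)])
  then show "\<exists>H. has_partial I \<beta> G H \<and> (\<exists>F. smooth_family I L F \<and> H = diff_quot k \<alpha> F)"
    using has_partial_diff_quot F(2) by blast
qed (use assms in auto)

text \<open>Taylor's theorem bounds the remainder; its partial derivatives are again remainders, of \<open>\<partial>\<^sub>\<beta> F\<close>
  instead of \<open>F\<close>, because \<open>\<partial>\<^sub>\<alpha>\<close> and \<open>\<partial>\<^sub>\<beta>\<close> commute.\<close>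

lemma smooth_family_diff_quot_remainder:
  assumes "smooth_family I L F" "has_partial I \<alpha> F G" "\<And>i. i \<in> I \<Longrightarrow> k i \<noteq> 0"
  shows "smooth_family I L (\<lambda>i x. (diff_quot k \<alpha> F i x - G i x) / k i)"
proof (rule smooth_family_coinduct[where Q = "\<lambda>R. \<exists>F G. smooth_family I L F \<and> has_partial I \<alpha> F G
    \<and> R = (\<lambda>i x. (diff_quot k \<alpha> F i x - G i x) / k i)"])
  fix R \<beta> assume "\<exists>F G. smooth_family I L F \<and> has_partial I \<alpha> F G
    \<and> R = (\<lambda>i x. (diff_quot k \<alpha> F i x - G i x) / k i)"
  then obtain F G where F: "smooth_family I L F" and G: "has_partial I \<alpha> F G"
    and R: "R = (\<lambda>i x. (diff_quot k \<alpha> F i x - G i x) / k i)" by blast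
  have sG: "smooth_family I L G" by (rule smooth_family_partial[OF F G])
  obtain H where H: "has_partial I \<alpha> G H" "smooth_family I L H" by (rule smooth_family_partialE[OF sG])
  obtain B where B: "\<And>i x. i \<in> I \<Longrightarrow> \<bar>H i x\<bar> \<le> B" using smooth_family_bound[OF H(2)] by metis
  have "\<bar>R i x\<bar> \<le> B" if "i \<in> I" for i x
  proof -
    have "R i x = (F i (x + axis \<alpha> (k i)) - F i x - k i * G i x) / (k i)\<^sup>2"
      using assms(3)[OF that] by (simp add: R diff_quot_def field_simps power2_eq_square)
    then show ?thesis
      using partial_taylor_le[OF G H(1) that B[OF that], of x "k i"] assms(3)[OF that]
      by (simp add: divide_le_eq)
  qed
  then show "bounded_periodic I L R"
    using periodic_diff_quot[OF smooth_family_bounded_periodic[OF F]] smooth_family_periodic[OF sG]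
    unfolding bounded_periodic_def R by auto
  obtain Fb where Fb: "has_partial I \<beta> F Fb" "smooth_family I L Fb" by (rule smooth_family_partialE[OF F])
  obtain Gb where Gb: "has_partial I \<beta> G Gb" "smooth_family I L Gb" by (rule smooth_family_partialE[OF sG])
  obtain Fba where Fba: "has_partial I \<alpha> Fb Fba" by (rule smooth_family_partialE[OF Fb(2)])
  have "Gb i = Fba i" if "i \<in> I" for i by (rule partials_commute[OF F that G Fb(1) Gb(1) Fba])
  then have "has_partial I \<alpha> Fb Gb" using Fba by (simp add: has_partial_def)
  moreover have "has_partial I \<beta> R (\<lambda>i x. (diff_quot k \<alpha> Fb i x - Gb i x) / k i)"
    using has_partial_diff_quot[OF Fb(1), of k \<alpha>] Gb(1) unfolding R has_partial_def
    by (intro ballI allI DERIV_cdivide DERIV_diff) auto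
  ultimately show "\<exists>R'. has_partial I \<beta> R R' \<and> (\<exists>F G. smooth_family I L F \<and> has_partial I \<alpha> F G
    \<and> R' = (\<lambda>i x. (diff_quot k \<alpha> F i x - G i x) / k i))"
    using Fb(2) by blast
qed (use assms in auto)

section \<open>Smooth coefficients and smooth solutions\<close>

lemma smooth_on_continuous: "smooth_on S f \<Longrightarrow> continuous_on S f"
  unfolding smooth_on_def by (metis Ck_on.simps(1))

lemma smooth_on_differentiable: "smooth_on S f \<Longrightarrow> x \<in> S \<Longrightarrow> f differentiable (at x)"
  unfolding smooth_on_def by (metis Ck_on.simps(2))

lemma smooth_on_derivative: "smooth_on S f \<Longrightarrow> smooth_on S (\<lambda>x. frechet_derivative f (at x) v)"
  unfolding smooth_on_def by (metis Ck_on.simps(2))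

lemma directional_derivative:
  fixes f :: "'a::real_normed_vector \<Rightarrow> real"
  assumes "f differentiable (at p)"
  shows "((\<lambda>s. f (p + s *\<^sub>R v)) has_real_derivative frechet_derivative f (at p) v) (at 0)"
proof -
  let ?f' = "frechet_derivative f (at p)"
  have f': "(f has_derivative ?f') (at p)" using assms by (simp add: frechet_derivative_works)
  have "((\<lambda>s. p + s *\<^sub>R v) has_derivative (\<lambda>s. s *\<^sub>R v)) (at 0)"
    by (auto intro!: derivative_eq_intros)
  moreover have "(f has_derivative ?f') (at (p + 0 *\<^sub>R v))" using f' by simp
  ultimately have "((\<lambda>s. f (p + s *\<^sub>R v)) has_derivative (\<lambda>s. ?f' (s *\<^sub>R v))) (at 0)"
    by (rule has_derivative_compose)
  then show ?thesis
    using linear_scale[OF has_derivative_linear[OF f']]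
    by (simp add: has_field_derivative_def mult.commute[of _ "?f' v"])
qed

lemma smooth_on_real_derivative:
  fixes M :: "real \<Rightarrow> real"
  assumes "smooth_on UNIV M"
  shows "(M has_real_derivative frechet_derivative M (at y) 1) (at y)"
  using directional_derivative[OF smooth_on_differentiable[OF assms UNIV_I], of y 1]
    DERIV_shift[of M _ 0 y] by (simp add: add.commute)

text \<open>Induction on the order for all \<open>M\<close> at once: the chain rule leads to \<open>M'\<close> composed with \<open>F\<close>. Smoothness of \<open>M\<close>
  on the whole line gives bounds because \<open>F\<close> takes its values in a fixed compact interval.\<close>

lemma smooth_family_compose:
  assumes "smooth_on UNIV M" "smooth_family I L F"
  shows "smooth_family I L (\<lambda>i x. M (F i x))"
  unfolding smooth_family_def
proof
  fix k
  obtain B where B: "\<And>i x. i \<in> I \<Longrightarrow> \<bar>F i x\<bar> \<le> B" using smooth_family_bound[OF assms(2)] by metis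
  have basic: "bounded_periodic I L (\<lambda>i x. M (F i x))" if M: "smooth_on UNIV M" for M :: "real \<Rightarrow> real"
  proof -
    have "compact (M ` {- B..B})"
      using continuous_on_subset[OF smooth_on_continuous[OF M]] by (intro compact_continuous_image) auto
    from compact_imp_bounded[OF this] obtain C where "\<forall>z\<in>M ` {- B..B}. norm z \<le> C"
      unfolding bounded_iff by blast
    then have C: "\<bar>M y\<bar> \<le> C" if "y \<in> {- B..B}" for y using that by simp
    have "\<bar>M (F i x)\<bar> \<le> C" if "i \<in> I" for i x using B[OF that, of x] by (intro C) (auto simp: abs_le_iff)
    then show ?thesis using smooth_family_periodic[OF assms(2)] by (auto simp: bounded_periodic_def)
  qed
  show "bounded_partials k I L (\<lambda>i x. M (F i x))" using assms(1)
  proof (induction k arbitrary: M)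
    case (Suc k)
    let ?M' = "\<lambda>y. frechet_derivative M (at y) 1"
    have "\<exists>G. has_partial I \<alpha> (\<lambda>i x. M (F i x)) G \<and> bounded_partials k I L G" for \<alpha>
    proof -
      obtain F' where F': "has_partial I \<alpha> F F'" "smooth_family I L F'"
        by (rule smooth_family_partialE[OF assms(2)])
      have "has_partial I \<alpha> (\<lambda>i x. M (F i x)) (\<lambda>i x. ?M' (F i x) * F' i x)"
        unfolding has_partial_def
      proof (intro ballI allI)
        fix i x assume "i \<in> I"
        then have "((\<lambda>s. F i (x + axis \<alpha> s)) has_real_derivative F' i x) (at 0)"
          using F'(1) by (simp add: has_partial_def)
        from DERIV_chain2[OF smooth_on_real_derivative[OF Suc.prems] this]
        show "((\<lambda>s. M (F i (x + axis \<alpha> s))) has_real_derivative ?M' (F i x) * F' i x) (at 0)"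
          by (simp add: axis_zero)
      qed
      moreover have "bounded_partials k I L (\<lambda>i x. ?M' (F i x) * F' i x)"
        using F'(2) Suc.IH[OF smooth_on_derivative[OF Suc.prems]]
        by (intro bounded_partials_mult) (simp_all add: smooth_family_def)
      ultimately show ?thesis by blast
    qed
    then show ?case using basic[OF Suc.prems] by simp
  qed (simp add: basic)
qed

lemma periodic_continuous_bounded:
  fixes f :: "real \<times> (real^'d::finite) \<Rightarrow> real"
  assumes "continuous_on ({0..T} \<times> UNIV) f" "L > 0"
    and per: "\<And>t x \<alpha>. t \<in> {0..T} \<Longrightarrow> f (t, x + axis \<alpha> L) = f (t, x)"
  shows "\<exists>B. \<forall>t\<in>{0..T}. \<forall>x. \<bar>f (t, x)\<bar> \<le> B"
proof -
  have "compact (f ` ({0..T} \<times> cbox 0 (\<chi> \<alpha>. L)))"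
    by (intro compact_continuous_image compact_Times continuous_on_subset[OF assms(1)]) auto
  from compact_imp_bounded[OF this] obtain B
    where "\<forall>y\<in>f ` ({0..T} \<times> cbox 0 (\<chi> \<alpha>. L)). norm y \<le> B" unfolding bounded_iff by blast
  then have B: "\<bar>f (t, x)\<bar> \<le> B" if "t \<in> {0..T}" "x \<in> cbox 0 (\<chi> \<alpha>. L)" for t x
    using that by simp
  have "\<bar>f (t, x)\<bar> \<le> B" if t: "t \<in> {0..T}" for t x
  proof -
    \<comment> \<open>The number of periods that moves each coordinate of \<open>x\<close> into \<open>[0,L]\<close>.\<close>
    define m where "m \<alpha> = - \<lfloor>x $ \<alpha> / L\<rfloor>" for \<alpha>
    have "x + (\<chi> \<alpha>. of_int (m \<alpha>) * L) \<in> cbox 0 (\<chi> \<alpha>. L)"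
      using floor_correct[of "x $ _ / L"] \<open>L > 0\<close>
      by (auto simp: mem_box_cart m_def le_divide_eq divide_less_eq algebra_simps less_imp_le)
    moreover have "f (t, x + (\<chi> \<alpha>. of_int (m \<alpha>) * L)) = f (t, x)"
      by (rule periodic_integer_combination[where f = "\<lambda>x. f (t, x)"]) (rule per[OF t])
    ultimately show ?thesis using B[OF t] by metis
  qed
  then show ?thesis by blast
qed

text \<open>Periodicity is required only for times in \<open>[0,T]\<close>, since nothing is known about the extension of a
  solution to times outside \<open>[0,T]\<close>.\<close>

definition strip_smooth :: "real set \<Rightarrow> real \<Rightarrow> real \<Rightarrow> (real \<times> (real^'d::finite) \<Rightarrow> real) \<Rightarrow> bool" where
  "strip_smooth S T L f \<longleftrightarrow> smooth_on (S \<times> UNIV) f \<and>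
     (\<forall>t\<in>{0..T}. \<forall>x \<alpha>. f (t, x + axis \<alpha> L) = f (t, x))"

lemma strip_smooth_space_derivative:
  fixes \<alpha> :: "'d::finite"
  assumes "strip_smooth S T L f" "{0..T} \<subseteq> S"
  defines "f' \<equiv> \<lambda>p. frechet_derivative f (at p) (0, axis \<alpha> 1)"
  shows "t \<in> {0..T} \<Longrightarrow> ((\<lambda>s. f (t, x + axis \<alpha> s)) has_real_derivative f' (t, x)) (at 0)"
    and "strip_smooth S T L f'"
proof -
  have d: "((\<lambda>s. f (t, x + axis \<alpha> s)) has_real_derivative f' (t, x)) (at 0)" if "t \<in> {0..T}" for t x
    using directional_derivative[of f "(t, x)" "(0, axis \<alpha> 1)"] assms that
      smooth_on_differentiable[of "S \<times> UNIV" f "(t, x)"]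
    by (auto simp: strip_smooth_def scaleR_axis_1)
  then show "t \<in> {0..T} \<Longrightarrow> ((\<lambda>s. f (t, x + axis \<alpha> s)) has_real_derivative f' (t, x)) (at 0)" .
  have "f' (t, x + axis \<beta> L) = f' (t, x)" if t: "t \<in> {0..T}" for t x \<beta>
  proof (rule DERIV_unique)
    have "f (t, x + axis \<beta> L + axis \<alpha> s) = f (t, x + axis \<alpha> s)" for s
    proof -
      have "f (t, (x + axis \<alpha> s) + axis \<beta> L) = f (t, x + axis \<alpha> s)"
        using assms(1) t by (simp only: strip_smooth_def)
      then show ?thesis by (simp add: ac_simps)
    qed
    then show "((\<lambda>s. f (t, x + axis \<alpha> s)) has_real_derivative f' (t, x + axis \<beta> L)) (at 0)"
      using d[OF t, of "x + axis \<beta> L"] by simp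
  qed (rule d[OF t])
  then show "strip_smooth S T L f'"
    using assms(1) smooth_on_derivative[of "S \<times> UNIV" f "(0, axis \<alpha> 1)"] by (simp add: strip_smooth_def f'_def)
qed

text \<open>At the end points of \<open>[0,T]\<close> periodicity holds on one side only; the one-sided derivative still determines
  the derivative, so that it is periodic there too.\<close>

lemma strip_smooth_time_derivative:
  assumes "strip_smooth S T L f" "{0..T} \<subseteq> S" "T > 0"
  defines "f' \<equiv> \<lambda>p. frechet_derivative f (at p) (1, 0)"
  shows "t \<in> {0..T} \<Longrightarrow> ((\<lambda>t. f (t, x)) has_real_derivative f' (t, x)) (at t)"
    and "strip_smooth S T L f'"
proof -
  have d: "((\<lambda>t. f (t, x)) has_real_derivative f' (t, x)) (at t)" if "t \<in> {0..T}" for t x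
    using directional_derivative[of f "(t, x)" "(1, 0)"] assms that
      smooth_on_differentiable[of "S \<times> UNIV" f "(t, x)"] DERIV_shift[of "\<lambda>t. f (t, x)" "f' (t, x)" 0 t]
    by (auto simp: strip_smooth_def add.commute)
  then show "t \<in> {0..T} \<Longrightarrow> ((\<lambda>t. f (t, x)) has_real_derivative f' (t, x)) (at t)" .
  have "f' (t, x + axis \<beta> L) = f' (t, x)" if t: "t \<in> {0..T}" for t x \<beta>
  proof (rule vector_derivative_unique_within_closed_interval[OF \<open>T > 0\<close>])
    show "t \<in> cbox 0 T" using t by simp
    show "((\<lambda>t. f (t, x)) has_vector_derivative f' (t, x)) (at t within cbox 0 T)"
      using d[OF t] by (simp add: has_real_derivative_iff_has_vector_derivative has_vector_derivative_at_within)
    have "((\<lambda>t. f (t, x + axis \<beta> L)) has_vector_derivative f' (t, x + axis \<beta> L)) (at t within cbox 0 T)"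
      using d[OF t] by (simp add: has_real_derivative_iff_has_vector_derivative has_vector_derivative_at_within)
    then show "((\<lambda>t. f (t, x)) has_vector_derivative f' (t, x + axis \<beta> L)) (at t within cbox 0 T)"
      by (rule has_vector_derivative_transform[rotated 2]) (use assms(1) t in \<open>auto simp: strip_smooth_def\<close>)
  qed
  then show "strip_smooth S T L f'"
    using assms(1) smooth_on_derivative[of "S \<times> UNIV" f "(1, 0)"] by (simp add: strip_smooth_def f'_def)
qed

lemma strip_smooth_bounded:
  assumes "strip_smooth S T L f" "{0..T} \<subseteq> S" "L > 0"
  shows "\<exists>B. \<forall>t\<in>{0..T}. \<forall>x. \<bar>f (t, x)\<bar> \<le> B"
proof (rule periodic_continuous_bounded[OF _ \<open>L > 0\<close>])
  show "continuous_on ({0..T} \<times> UNIV) f"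
    using assms by (intro continuous_on_subset[OF smooth_on_continuous]) (auto simp: strip_smooth_def)
qed (use assms in \<open>auto simp: strip_smooth_def\<close>)

lemma strip_smooth_family:
  assumes "strip_smooth S T L f" "{0..T} \<subseteq> S" "L > 0" "\<And>i. i \<in> I \<Longrightarrow> \<tau> i \<in> {0..T}"
  shows "smooth_family I L (\<lambda>i x. f (\<tau> i, x))"
proof (rule smooth_family_coinduct[where Q = "\<lambda>F. \<exists>f. strip_smooth S T L f \<and> F = (\<lambda>i x. f (\<tau> i, x))"])
  fix F \<alpha> assume "\<exists>f. strip_smooth S T L f \<and> F = (\<lambda>i x. f (\<tau> i, x))"
  then obtain f where f: "strip_smooth S T L f" and F: "F = (\<lambda>i x. f (\<tau> i, x))" by blast
  obtain B where "\<forall>t\<in>{0..T}. \<forall>x. \<bar>f (t, x)\<bar> \<le> B" using strip_smooth_bounded[OF f assms(2,3)] by blast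
  then show "bounded_periodic I L F"
    using f assms(4) unfolding F bounded_periodic_def strip_smooth_def by blast
  show "\<exists>G. has_partial I \<alpha> F G \<and> (\<exists>f. strip_smooth S T L f \<and> G = (\<lambda>i x. f (\<tau> i, x)))"
  proof (intro exI conjI)
    let ?f' = "\<lambda>p. frechet_derivative f (at p) (0, axis \<alpha> 1)"
    show "has_partial I \<alpha> F (\<lambda>i x. ?f' (\<tau> i, x))"
      unfolding F has_partial_def by (intro ballI allI strip_smooth_space_derivative(1)[OF f assms(2) assms(4)])
    show "strip_smooth S T L ?f'" by (rule strip_smooth_space_derivative(2)[OF f assms(2)])
  qed simp
qed (use assms in auto)

text \<open>Taylor's theorem; the second time derivative is bounded because two time derivatives preserve
  periodicity.\<close>

lemma forward_difference_time:
  assumes f: "strip_smooth S T L f" "{0..T} \<subseteq> S" "L > 0" "T > 0"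
  shows "\<exists>B>0. \<forall>t x dt. 0 < dt \<and> t \<in> {0..T - dt} \<longrightarrow>
    \<bar>(f (t + dt, x) - f (t, x)) / dt - deriv (\<lambda>t. f (t, x)) t\<bar> \<le> B * dt"
proof -
  let ?D = "\<lambda>f p. frechet_derivative f (at p) (1, 0)"
  note d1 = strip_smooth_time_derivative[OF f(1,2,4)]
  note d2 = strip_smooth_time_derivative[OF d1(2) f(2,4)]
  obtain B0 where B0: "\<forall>t\<in>{0..T}. \<forall>x. \<bar>?D (?D f) (t, x)\<bar> \<le> B0"
    using strip_smooth_bounded[OF d2(2) f(2,3)] by blast
  define B where "B = max B0 1"
  have B: "\<bar>?D (?D f) (t, x)\<bar> \<le> B" if "t \<in> {0..T}" for t x
    using B0 that unfolding B_def by (meson max.coboundedI1)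
  have Bpos: "B > 0" by (simp add: B_def)
  have "\<bar>(f (t + dt, x) - f (t, x)) / dt - deriv (\<lambda>t. f (t, x)) t\<bar> \<le> B * dt"
    if dt: "0 < dt" and t: "t \<in> {0..T - dt}" for t x dt
  proof -
    let ?I = "{t..t + dt}"
    have sub: "s \<in> {0..T}" if "s \<in> ?I" for s using that t dt by auto
    have "norm ((f (t + dt, x) - (t + dt) * ?D f (t, x)) - (f (t, x) - t * ?D f (t, x)))
        \<le> (B * dt) * norm ((t + dt) - t)"
    proof (rule field_differentiable_bound[where S = ?I and f = "\<lambda>s. f (s, x) - s * ?D f (t, x)"])
      fix s assume s: "s \<in> ?I"
      show "((\<lambda>s. f (s, x) - s * ?D f (t, x)) has_field_derivative ?D f (s, x) - ?D f (t, x)) (at s within ?I)"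
        by (rule derivative_eq_intros has_field_derivative_at_within[OF d1(1)[OF sub[OF s]]] refl | simp)+
      have "norm (?D f (s, x) - ?D f (t, x)) \<le> B * norm (s - t)"
      proof (rule field_differentiable_bound[where S = ?I and f = "\<lambda>s. ?D f (s, x)"])
        fix r assume r: "r \<in> ?I"
        show "((\<lambda>s. ?D f (s, x)) has_field_derivative ?D (?D f) (r, x)) (at r within ?I)"
          by (rule has_field_derivative_at_within[OF d2(1)[OF sub[OF r]]])
        show "norm (?D (?D f) (r, x)) \<le> B" using B[OF sub[OF r]] by simp
      qed (use s dt in auto)
      also have "\<dots> \<le> B * dt" using s Bpos by (intro mult_left_mono) auto
      finally show "norm (?D f (s, x) - ?D f (t, x)) \<le> B * dt" .
    qed (use dt in auto)
    then have "\<bar>f (t + dt, x) - f (t, x) - dt * ?D f (t, x)\<bar> \<le> B * dt * dt"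
      using dt by (simp add: algebra_simps)
    moreover have "(f (t + dt, x) - f (t, x)) / dt - ?D f (t, x) = (f (t + dt, x) - f (t, x) - dt * ?D f (t, x)) / dt"
      using dt by (simp add: diff_divide_distrib)
    moreover have "deriv (\<lambda>t. f (t, x)) t = ?D f (t, x)"
      using t dt by (intro DERIV_imp_deriv d1(1)) auto
    ultimately show ?thesis using dt by (simp add: divide_le_eq)
  qed
  then show ?thesis using Bpos by blast
qed

section \<open>Difference calculus to all orders and defect correction\<close>

locale mesh_family =
  fixes I :: "'i set" and L :: real and h :: "'i \<Rightarrow> real" and H :: real
  assumes h_pos: "i \<in> I \<Longrightarrow> h i > 0" and h_le: "i \<in> I \<Longrightarrow> h i \<le> H"
begin

abbreviation smooth :: "('i \<Rightarrow> real^'d::finite \<Rightarrow> real) \<Rightarrow> bool" where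
  "smooth F \<equiv> smooth_family I L F"

text \<open>The error of a first-order approximation, divided by the mesh width, is required to be a smooth family, so that
  differences may be applied to it any number of times without loss of order.\<close>

definition approx :: "('i \<Rightarrow> real^'d::finite \<Rightarrow> real) \<Rightarrow> ('i \<Rightarrow> real^'d \<Rightarrow> real) \<Rightarrow> bool" where
  "approx F F0 \<longleftrightarrow> smooth F0 \<and> (\<exists>R. smooth R \<and> (\<forall>i\<in>I. \<forall>x. F i x = F0 i x + h i * R i x))"

lemma smooth_mesh: "smooth (\<lambda>i x. h i)"
  by (rule smooth_family_const[where B = H]) (use h_pos h_le in \<open>simp add: less_imp_le\<close>)

lemma smooth_mesh_power: "smooth F \<Longrightarrow> smooth (\<lambda>i x. h i ^ k * F i x)"
proof (induction k)
  case (Suc k)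
  then show ?case using smooth_family_mult[OF smooth_mesh, of "\<lambda>i x. h i ^ k * F i x"] by (simp add: mult.assoc)
qed simp

lemma smooth_mesh_mult: "smooth F \<Longrightarrow> smooth (\<lambda>i x. h i * F i x)"
  by (rule smooth_family_mult[OF smooth_mesh])

lemma approxI:
  assumes "smooth F0" "smooth R" "\<And>i x. i \<in> I \<Longrightarrow> F i x = F0 i x + h i * R i x"
  shows "approx F F0"
  using assms by (auto simp: approx_def)

lemma approxE:
  assumes "approx F F0"
  obtains R where "smooth R" "\<And>i x. i \<in> I \<Longrightarrow> F i x = F0 i x + h i * R i x" "smooth F0"
  using assms by (auto simp: approx_def)

lemma approx_smooth:
  assumes "approx F F0"
  shows "smooth F"
proof -
  obtain R where R: "smooth R" "\<And>i x. i \<in> I \<Longrightarrow> F i x = F0 i x + h i * R i x" "smooth F0"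
    using approxE[OF assms] by metis
  have "smooth (\<lambda>i x. F0 i x + h i * R i x)"
    using R by (intro smooth_family_add smooth_mesh_mult)
  then show ?thesis by (rule smooth_family_cong[rotated]) (simp add: R(2) fun_eq_iff)
qed

lemma approx_refl: "smooth F \<Longrightarrow> approx F F"
  by (rule approxI[of _ "\<lambda>i x. 0"]) (simp_all add: smooth_family_const[where B = 0])

lemma approx_add:
  assumes "approx F F0" "approx G G0"
  shows "approx (\<lambda>i x. F i x + G i x) (\<lambda>i x. F0 i x + G0 i x)"
proof -
  obtain R where R: "smooth R" "\<And>i x. i \<in> I \<Longrightarrow> F i x = F0 i x + h i * R i x" "smooth F0"
    using approxE[OF assms(1)] by metis
  obtain S where S: "smooth S" "\<And>i x. i \<in> I \<Longrightarrow> G i x = G0 i x + h i * S i x" "smooth G0"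
    using approxE[OF assms(2)] by metis
  show ?thesis
    by (rule approxI[of _ "\<lambda>i x. R i x + S i x"]) (use R S in \<open>simp_all add: smooth_family_add algebra_simps\<close>)
qed

lemma approx_mult:
  assumes "approx F F0" "approx G G0"
  shows "approx (\<lambda>i x. F i x * G i x) (\<lambda>i x. F0 i x * G0 i x)"
proof -
  obtain R where R: "smooth R" "\<And>i x. i \<in> I \<Longrightarrow> F i x = F0 i x + h i * R i x" "smooth F0"
    using approxE[OF assms(1)] by metis
  obtain S where S: "smooth S" "\<And>i x. i \<in> I \<Longrightarrow> G i x = G0 i x + h i * S i x" "smooth G0"
    using approxE[OF assms(2)] by metis
  have "smooth (\<lambda>i x. F0 i x * S i x + R i x * G i x)"
    using R S approx_smooth[OF assms(2)] by (intro smooth_family_add smooth_family_mult)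
  then show ?thesis
    by (rule approxI[rotated]) (use R S in \<open>simp_all add: smooth_family_mult algebra_simps\<close>)
qed

lemma approx_cmult: "approx F F0 \<Longrightarrow> approx (\<lambda>i x. c * F i x) (\<lambda>i x. c * F0 i x)"
  by (rule approx_mult[OF approx_refl[OF smooth_family_const[where B = "\<bar>c\<bar>"]]]) simp_all

lemma approx_diff: "approx F F0 \<Longrightarrow> approx G G0 \<Longrightarrow> approx (\<lambda>i x. F i x - G i x) (\<lambda>i x. F0 i x - G0 i x)"
  using approx_add[OF _ approx_cmult[of G G0 "-1"]] by simp

lemma approx_sum:
  "finite A \<Longrightarrow> (\<And>a. a \<in> A \<Longrightarrow> approx (F a) (F0 a)) \<Longrightarrow>
    approx (\<lambda>i x. \<Sum>a\<in>A. F a i x) (\<lambda>i x. \<Sum>a\<in>A. F0 a i x)"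
  by (induction A rule: finite_induct)
    (simp_all add: approx_add approx_refl smooth_family_const[where B = 0])

lemma approx_perturb:
  assumes "approx F F0" "smooth R"
  shows "approx (\<lambda>i x. F i x - h i * R i x) F0"
proof -
  have "approx (\<lambda>i x. h i * R i x) (\<lambda>i x. 0)"
    by (rule approxI[of _ R]) (simp_all add: assms(2) smooth_family_const[where B = 0])
  from approx_diff[OF assms(1) this] show ?thesis by simp
qed

lemma approx_diff_quot:
  assumes "approx F F0" "\<sigma> \<noteq> 0"
  shows "approx (diff_quot (\<lambda>i. \<sigma> * h i) \<alpha> F) (\<lambda>i. pderiv_at \<alpha> (F0 i))"
proof -
  let ?k = "\<lambda>i. \<sigma> * h i" and ?G = "\<lambda>i. pderiv_at \<alpha> (F0 i)"
  obtain R where R: "smooth R" "\<And>i x. i \<in> I \<Longrightarrow> F i x = F0 i x + h i * R i x" "smooth F0"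
    using approxE[OF assms(1)] by metis
  have k: "?k i \<noteq> 0" if "i \<in> I" for i using h_pos[OF that] assms(2) by simp
  let ?E = "\<lambda>i x. (diff_quot ?k \<alpha> F0 i x - ?G i x) / ?k i"
  have E: "smooth ?E"
    by (rule smooth_family_diff_quot_remainder[OF R(3) smooth_family_pderiv(1)[OF R(3)] k])
  show ?thesis
  proof (rule approxI)
    show "smooth ?G" by (rule smooth_family_pderiv(2)[OF R(3)])
    show "smooth (\<lambda>i x. \<sigma> * ?E i x + diff_quot ?k \<alpha> R i x)"
      by (intro smooth_family_add smooth_family_cmult E smooth_family_diff_quot R k)
    fix i x assume i: "i \<in> I"
    have "diff_quot ?k \<alpha> F i x = diff_quot ?k \<alpha> F0 i x + h i * diff_quot ?k \<alpha> R i x"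
      by (simp add: diff_quot_def R(2)[OF i] add_divide_distrib diff_divide_distrib right_diff_distrib)
    also have "diff_quot ?k \<alpha> F0 i x = ?G i x + ?k i * ?E i x" using k[OF i] by simp
    finally show "diff_quot ?k \<alpha> F i x = ?G i x + h i * (\<sigma> * ?E i x + diff_quot ?k \<alpha> R i x)"
      by (simp only: distrib_left mult.assoc mult.commute[of \<sigma>] add.assoc mult.left_commute)
  qed
qed

text \<open>The factor \<open>1\<close> matches \<open>approx_diff_quot\<close>, where forward and backward steps are the multiples
  \<open>1\<close> and \<open>- 1\<close> of the mesh width.\<close>

definition forward_diff :: "'d \<Rightarrow> ('i \<Rightarrow> real^'d::finite \<Rightarrow> real) \<Rightarrow> 'i \<Rightarrow> real^'d \<Rightarrow> real" where
  "forward_diff = diff_quot (\<lambda>i. 1 * h i)"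

definition backward_diff :: "'d \<Rightarrow> ('i \<Rightarrow> real^'d::finite \<Rightarrow> real) \<Rightarrow> 'i \<Rightarrow> real^'d \<Rightarrow> real" where
  "backward_diff = diff_quot (\<lambda>i. - 1 * h i)"

definition mesh_div :: "('d \<Rightarrow> 'i \<Rightarrow> real^'d::finite \<Rightarrow> real) \<Rightarrow> 'i \<Rightarrow> real^'d \<Rightarrow> real" where
  "mesh_div Q i x = (\<Sum>\<beta>\<in>UNIV. backward_diff \<beta> (Q \<beta>) i x)"

definition mesh_lap :: "('i \<Rightarrow> real^'d::finite \<Rightarrow> real) \<Rightarrow> 'i \<Rightarrow> real^'d \<Rightarrow> real" where
  "mesh_lap F = mesh_div (\<lambda>\<beta>. forward_diff \<beta> F)"

text \<open>The stabilising part of \<open>flux_op\<close>, divided by the mesh width and with opposite sign, acting on functions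
  of a continuous variable instead of grid functions.\<close>

definition regularisation :: "real \<Rightarrow> real \<Rightarrow> ('d \<Rightarrow> 'i \<Rightarrow> real^'d::finite \<Rightarrow> real) \<Rightarrow> 'd \<Rightarrow> 'i \<Rightarrow> real^'d \<Rightarrow> real" where
  "regularisation c c' Q \<alpha> i x = c * mesh_lap (Q \<alpha>) i x - c' * forward_diff \<alpha> (mesh_lap (mesh_div Q)) i x"

lemma approx_forward_diff: "approx F F0 \<Longrightarrow> approx (forward_diff \<alpha> F) (\<lambda>i. pderiv_at \<alpha> (F0 i))"
  unfolding forward_diff_def by (rule approx_diff_quot) simp_all

lemma approx_backward_diff: "approx F F0 \<Longrightarrow> approx (backward_diff \<alpha> F) (\<lambda>i. pderiv_at \<alpha> (F0 i))"
  unfolding backward_diff_def by (rule approx_diff_quot) simp_all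

lemma approx_mesh_div:
  assumes "\<And>\<alpha>. approx (Q \<alpha>) (\<lambda>i x. Q0 i x $ \<alpha>)"
  shows "approx (mesh_div Q) (\<lambda>i. divergence (Q0 i))"
  unfolding mesh_div_def divergence_def by (intro approx_sum approx_backward_diff assms) simp

lemma approx_mesh_lap: "approx F F0 \<Longrightarrow> approx (mesh_lap F) (\<lambda>i. laplacian (F0 i))"
  unfolding mesh_lap_def laplacian_def by (rule approx_mesh_div) (simp add: grad_def approx_forward_diff)

lemma smooth_forward_diff: "smooth F \<Longrightarrow> smooth (forward_diff \<alpha> F)"
  using approx_smooth approx_forward_diff approx_refl by blast

lemma smooth_backward_diff: "smooth F \<Longrightarrow> smooth (backward_diff \<alpha> F)"
  using approx_smooth approx_backward_diff approx_refl by blast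

lemma smooth_mesh_div: "(\<And>\<alpha>. smooth (Q \<alpha>)) \<Longrightarrow> smooth (mesh_div Q)"
  unfolding mesh_div_def by (intro smooth_family_sum smooth_backward_diff) simp_all

lemma smooth_mesh_lap: "smooth F \<Longrightarrow> smooth (mesh_lap F)"
  unfolding mesh_lap_def by (intro smooth_mesh_div smooth_forward_diff)

lemma smooth_regularisation: "(\<And>\<alpha>. smooth (Q \<alpha>)) \<Longrightarrow> smooth (regularisation c c' Q \<alpha>)"
  unfolding regularisation_def by (intro smooth_family_diff smooth_family_cmult smooth_mesh_lap smooth_forward_diff smooth_mesh_div)

lemma diff_quot_linear:
  "diff_quot k \<alpha> (\<lambda>i x. F i x - c i * G i x) = (\<lambda>i x. diff_quot k \<alpha> F i x - c i * diff_quot k \<alpha> G i x)"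
  by (simp add: diff_quot_def fun_eq_iff diff_divide_distrib right_diff_distrib)

lemma mesh_div_linear:
  "mesh_div (\<lambda>\<alpha> i x. F \<alpha> i x - c i * G \<alpha> i x) = (\<lambda>i x. mesh_div F i x - c i * mesh_div G i x)"
  by (simp add: mesh_div_def fun_eq_iff backward_diff_def diff_quot_linear sum_subtractf sum_distrib_left)

lemma mesh_lap_linear: "mesh_lap (\<lambda>i x. F i x - c i * G i x) = (\<lambda>i x. mesh_lap F i x - c i * mesh_lap G i x)"
  unfolding mesh_lap_def forward_diff_def diff_quot_linear by (rule mesh_div_linear)

lemma regularisation_linear:
  "regularisation a b (\<lambda>\<alpha> i x. F \<alpha> i x - c i * G \<alpha> i x) \<alpha> i x = regularisation a b F \<alpha> i x - c i * regularisation a b G \<alpha> i x"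
  unfolding regularisation_def mesh_lap_linear mesh_div_linear forward_diff_def diff_quot_linear by (simp add: algebra_simps)

text \<open>Let \<open>A\<close> be the operator on the left. Because \<open>A (M \<rho>) = \<rho> - h B (M \<rho>)\<close> with \<open>B\<close> the regularisation, the
  correction \<open>- h\<^sup>k M \<rho>\<close> replaces a residual \<open>h\<^sup>k \<rho>\<close> by \<open>h\<^sup>k\<^sup>+\<^sup>1 B (M \<rho>)\<close>. With \<open>k \<ge> 1\<close> the correction is of order \<open>h\<close>, so the
  leading term \<open>M g\<^sub>0\<close> is the same for all \<open>K\<close>.\<close>

lemma defect_correction:
  assumes M: "smooth M" "\<And>i x. i \<in> I \<Longrightarrow> M i x > 0" and g: "\<And>\<alpha>. approx (g \<alpha>) (g0 \<alpha>)"
  shows "\<exists>Q \<rho>. (\<forall>\<alpha>. approx (Q \<alpha>) (\<lambda>i x. M i x * g0 \<alpha> i x)) \<and> (\<forall>\<alpha>. smooth (\<rho> \<alpha>)) \<and>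
    (\<forall>\<alpha>. \<forall>i\<in>I. \<forall>x. Q \<alpha> i x / M i x - h i * regularisation c c' Q \<alpha> i x = g \<alpha> i x + h i ^ Suc K * \<rho> \<alpha> i x)"
proof (induction K)
  case 0
  let ?Q = "\<lambda>\<alpha> i x. M i x * g \<alpha> i x"
  have Q: "approx (?Q \<alpha>) (\<lambda>i x. M i x * g0 \<alpha> i x)" for \<alpha>
    by (intro approx_mult approx_refl M g)
  have "smooth (\<lambda>i x. (-1) * regularisation c c' ?Q \<alpha> i x)" for \<alpha>
    by (intro smooth_family_cmult smooth_regularisation approx_smooth[OF Q])
  moreover have "?Q \<alpha> i x / M i x - h i * regularisation c c' ?Q \<alpha> i x = g \<alpha> i x + h i ^ Suc 0 * ((-1) * regularisation c c' ?Q \<alpha> i x)"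
    if "i \<in> I" for \<alpha> i x using M(2)[OF that, of x] by simp
  ultimately show ?case using Q
    by (intro exI[of _ ?Q] exI[of _ "\<lambda>\<alpha> i x. (-1) * regularisation c c' ?Q \<alpha> i x"]) blast
next
  case (Suc K)
  then obtain Q \<rho> where Q: "\<And>\<alpha>. approx (Q \<alpha>) (\<lambda>i x. M i x * g0 \<alpha> i x)" and \<rho>: "\<And>\<alpha>. smooth (\<rho> \<alpha>)"
    and eq: "\<And>\<alpha> i x. i \<in> I \<Longrightarrow> Q \<alpha> i x / M i x - h i * regularisation c c' Q \<alpha> i x = g \<alpha> i x + h i ^ Suc K * \<rho> \<alpha> i x"
    by blast
  let ?R = "\<lambda>\<alpha> i x. M i x * \<rho> \<alpha> i x"
  let ?Q = "\<lambda>\<alpha> i x. Q \<alpha> i x - h i ^ Suc K * ?R \<alpha> i x"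
  have R: "smooth (?R \<alpha>)" for \<alpha> by (intro smooth_family_mult M \<rho>)
  have "approx (?Q \<alpha>) (\<lambda>i x. M i x * g0 \<alpha> i x)" for \<alpha>
    using approx_perturb[OF Q smooth_mesh_power[OF R], of \<alpha> K \<alpha>] by (simp add: mult.assoc)
  moreover have "smooth (regularisation c c' ?R \<alpha>)" for \<alpha> by (intro smooth_regularisation R)
  moreover have "?Q \<alpha> i x / M i x - h i * regularisation c c' ?Q \<alpha> i x = g \<alpha> i x + h i ^ Suc (Suc K) * regularisation c c' ?R \<alpha> i x"
    if "i \<in> I" for \<alpha> i x
  proof -
    have quotient: "?Q \<alpha> i x / M i x = Q \<alpha> i x / M i x - h i ^ Suc K * \<rho> \<alpha> i x"
      using M(2)[OF that, of x] by (simp add: field_simps)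
    have regularised: "regularisation c c' ?Q \<alpha> i x = regularisation c c' Q \<alpha> i x - h i ^ Suc K * regularisation c c' ?R \<alpha> i x"
      by (rule regularisation_linear)
    show ?thesis unfolding quotient regularised using eq[OF that, of \<alpha> x] by (simp add: algebra_simps)
  qed
  ultimately show ?case by (intro exI[of _ ?Q] exI[of _ "regularisation c c' ?R"]) blast
qed

end

section \<open>Consistency of the limit scheme\<close>

lemma grid_point_plus: "grid_point a dx (j + axis \<alpha> k) = grid_point a dx j + axis \<alpha> (of_int k * dx)"
  by (simp add: grid_point_def vec_eq_iff axis_def algebra_simps)

lemma grid_point_minus: "grid_point a dx (j - axis \<alpha> k) = grid_point a dx j + axis \<alpha> (- (of_int k * dx))"
  by (simp add: grid_point_def vec_eq_iff axis_def algebra_simps)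

lemma grid_periodic_restrict:
  assumes "\<And>x \<alpha>. f (x + axis \<alpha> L) = f x" "real N * dx = L"
  shows "grid_periodic N (\<lambda>j. f (grid_point a dx j))"
  using assms by (simp add: grid_periodic_def grid_point_plus)

context mesh_family
begin

lemma D_plus_restrict:
  "D_plus (h i) \<alpha> (\<lambda>j. F i (grid_point a (h i) j)) = (\<lambda>j. forward_diff \<alpha> F i (grid_point a (h i) j))"
  by (simp add: D_plus_def forward_diff_def diff_quot_def grid_point_plus fun_eq_iff)

lemma D_minus_restrict:
  "D_minus (h i) \<alpha> (\<lambda>j. F i (grid_point a (h i) j)) = (\<lambda>j. backward_diff \<alpha> F i (grid_point a (h i) j))"
proof
  fix j
  have flip_sign: "(u - w) / k = (w - u) / (- k)" for u w k :: real
    by (cases "k = 0") (simp_all add: field_simps)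
  show "D_minus (h i) \<alpha> (\<lambda>j. F i (grid_point a (h i) j)) j = backward_diff \<alpha> F i (grid_point a (h i) j)"
    unfolding D_minus_def backward_diff_def diff_quot_def grid_point_minus
    by (simp only: of_int_1 mult_1 mult_minus1) (rule flip_sign)
qed

lemma grad_h_restrict:
  "grad_h (h i) (\<lambda>j. F i (grid_point a (h i) j)) = (\<lambda>j. \<chi> \<alpha>. forward_diff \<alpha> F i (grid_point a (h i) j))"
  by (simp add: grad_h_def D_plus_restrict fun_eq_iff)

lemma div_h_restrict:
  "div_h (h i) (\<lambda>j. \<chi> \<alpha>. Q \<alpha> i (grid_point a (h i) j)) = (\<lambda>j. mesh_div Q i (grid_point a (h i) j))"
  by (simp add: div_h_def mesh_div_def D_minus_restrict fun_eq_iff)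

lemma lap_h_restrict:
  "lap_h (h i) (\<lambda>j. F i (grid_point a (h i) j)) = (\<lambda>j. mesh_lap F i (grid_point a (h i) j))"
  by (simp add: lap_h_def mesh_lap_def grad_h_restrict div_h_restrict[of i "\<lambda>\<beta>. forward_diff \<beta> F"])

lemma flux_op_restrict:
  "flux_op P (h i) (\<lambda>j. M i (grid_point a (h i) j)) (\<lambda>j. \<chi> \<alpha>. Q \<alpha> i (grid_point a (h i) j)) =
    (\<lambda>j. \<chi> \<alpha>. Q \<alpha> i (grid_point a (h i) j) / M i (grid_point a (h i) j)
      - h i * regularisation (cq P) (cw P) Q \<alpha> i (grid_point a (h i) j))"
  by (simp add: flux_op_def fun_eq_iff vec_eq_iff vlap_h_def lap_h_restrict div_h_restrict grad_h_restrict
      regularisation_def algebra_simps)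

end

text \<open>One value is bounded by the sum of all squares, and there are at most \<open>(L / dx)\<^sup>d\<close> of them; the order
  \<open>d + 2\<close> of the right-hand side leaves the power \<open>dx\<^sup>2\<close>, one of which is spent on the divergence.\<close>

lemma flux_op_small_rhs:
  fixes q :: "int^'d::finite \<Rightarrow> real^'d"
  assumes "grid_periodic N q" "N > 0" "dx > 0" "cq P > 0" "cw P > 0" "real N * dx = L"
    and m: "\<And>j. m j > 0" "\<And>j. m j \<le> B"
    and rhs: "\<And>j \<alpha>. \<bar>flux_op P dx m q j $ \<alpha>\<bar> \<le> R * dx ^ (CARD('d) + 2)"
  shows "\<bar>q j $ \<alpha>\<bar> \<le> B * R * sqrt CARD('d) * L ^ CARD('d) * dx\<^sup>2"
proof -
  let ?d = "CARD('d)"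
  let ?\<tau> = "flux_op P dx m q"
  have Bpos: "B > 0" using m less_le_trans by blast
  have R: "R \<ge> 0"
  proof -
    have "0 \<le> R * dx ^ (?d + 2)" using rhs abs_ge_zero order_trans by blast
    then show ?thesis using zero_less_power[OF \<open>dx > 0\<close>] by (meson mult_neg_pos not_le)
  qed
  have dxL: "dx \<le> L"
  proof -
    have "1 * dx \<le> real N * dx" using \<open>N > 0\<close> \<open>dx > 0\<close> by (intro mult_right_mono) auto
    then show ?thesis using assms(6) by simp
  qed
  have \<tau>: "(norm (?\<tau> j))\<^sup>2 \<le> real ?d * (R * dx ^ (?d + 2))\<^sup>2" for j
  proof -
    have "(norm (?\<tau> j))\<^sup>2 = (\<Sum>\<alpha>\<in>UNIV. (?\<tau> j $ \<alpha>)\<^sup>2)"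
      unfolding power2_norm_eq_inner inner_vec_def by (simp add: power2_eq_square)
    also have "\<dots> \<le> (\<Sum>\<alpha>\<in>(UNIV::'d set). (R * dx ^ (?d + 2))\<^sup>2)"
      by (rule sum_mono) (rule abs_le_square_iff[THEN iffD1], use rhs in \<open>simp add: abs_of_nonneg R \<open>dx > 0\<close> less_imp_le\<close>)
    finally show ?thesis by simp
  qed
  have "(q j $ \<alpha>)\<^sup>2 \<le> (norm (q (wrap N j)))\<^sup>2"
    using component_le_norm_cart[of "q j" \<alpha>] grid_periodic_wrap[OF assms(1), of j]
    by (simp add: abs_le_square_iff[symmetric])
  also have "\<dots> \<le> (\<Sum>j\<in>grid_cell N. (norm (q j))\<^sup>2)"
    by (rule member_le_sum) (use wrap_in_cell[OF \<open>N > 0\<close>] in \<open>auto simp: finite_grid_cell\<close>)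
  also have "\<dots> \<le> (\<Sum>j\<in>grid_cell N. (norm (?\<tau> j))\<^sup>2) / (1 / B)\<^sup>2"
    using assms(1-5) Bpos m by (intro flux_op_stable) (auto simp: frac_le)
  also have "\<dots> = B\<^sup>2 * (\<Sum>j\<in>grid_cell N. (norm (?\<tau> j))\<^sup>2)"
    by (simp add: power_divide mult.commute)
  also have "\<dots> \<le> B\<^sup>2 * (real (N ^ ?d) * (real ?d * (R * dx ^ (?d + 2))\<^sup>2))"
  proof (rule mult_left_mono)
    have "(\<Sum>j\<in>grid_cell N. (norm (?\<tau> j))\<^sup>2) \<le> real (card (grid_cell N :: (int^'d) set)) * (real ?d * (R * dx ^ (?d + 2))\<^sup>2)"
      using \<tau> by (intro sum_bounded_above) auto
    also have "\<dots> \<le> real (N ^ ?d) * (real ?d * (R * dx ^ (?d + 2))\<^sup>2)"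
      by (intro mult_right_mono of_nat_mono card_grid_cell_le) auto
    finally show "(\<Sum>j\<in>grid_cell N. (norm (?\<tau> j))\<^sup>2) \<le> real (N ^ ?d) * (real ?d * (R * dx ^ (?d + 2))\<^sup>2)" .
  qed simp
  also have "\<dots> = B\<^sup>2 * R\<^sup>2 * real ?d * (L ^ ?d * dx ^ ?d * (dx\<^sup>2)\<^sup>2)"
    by (simp add: assms(6)[symmetric] power_mult_distrib power_add power2_eq_square)
  also have "\<dots> \<le> B\<^sup>2 * R\<^sup>2 * real ?d * (L ^ ?d * L ^ ?d * (dx\<^sup>2)\<^sup>2)"
    using dxL \<open>dx > 0\<close> by (intro mult_left_mono mult_right_mono power_mono) auto
  also have "\<dots> = (B * R * sqrt ?d * L ^ ?d * dx\<^sup>2)\<^sup>2"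
    by (simp add: power_mult_distrib power2_eq_square[of "L ^ _"])
  finally have "(q j $ \<alpha>)\<^sup>2 \<le> (B * R * sqrt ?d * L ^ ?d * dx\<^sup>2)\<^sup>2" .
  moreover have "B * R * sqrt ?d * L ^ ?d * dx\<^sup>2 \<ge> 0" using Bpos R dxL \<open>dx > 0\<close> by simp
  ultimately show ?thesis by (simp add: abs_le_square_iff[symmetric])
qed

lemma div_h_le:
  fixes e :: "int^'d::finite \<Rightarrow> real^'d"
  assumes "\<And>j \<alpha>. \<bar>e j $ \<alpha>\<bar> \<le> E * dx\<^sup>2" "dx > 0"
  shows "\<bar>div_h dx e j\<bar> \<le> 2 * real CARD('d) * E * dx"
proof -
  have "\<bar>D_minus dx \<alpha> (\<lambda>i. e i $ \<alpha>) j\<bar> \<le> 2 * E * dx" for \<alpha>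
  proof -
    have "\<bar>e j $ \<alpha> - e (j - axis \<alpha> 1) $ \<alpha>\<bar> \<le> 2 * E * dx\<^sup>2"
      using assms(1)[of j \<alpha>] assms(1)[of "j - axis \<alpha> 1" \<alpha>] by linarith
    then show ?thesis using \<open>dx > 0\<close> by (simp add: D_minus_def divide_le_eq power2_eq_square mult.assoc)
  qed
  then have "\<bar>div_h dx e j\<bar> \<le> (\<Sum>\<alpha>\<in>(UNIV::'d set). 2 * E * dx)"
    unfolding div_h_def by (intro order_trans[OF sum_abs] sum_mono)
  then show ?thesis by simp
qed

text \<open>The error of the flux against the approximate flux \<open>Q\<close> is small by stability, and the divergence of
  \<open>Q\<close> is consistent by the difference calculus.\<close>

lemma flux_divergence_consistent:
  fixes v :: "real \<Rightarrow> real^'d::finite \<Rightarrow> real"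
  assumes "a < b" "standing_assumptions P" "T > 0"
    and v: "strip_smooth S T (b - a) (\<lambda>(t, x). v t x)" "{0..T} \<subseteq> S"
  shows "\<exists>C>0. \<forall>N>0. \<forall>t\<in>{0..T}. \<forall>j. let dx = (b - a) / real N in
    \<bar>div_h dx (flux P dx N (\<lambda>i. v t (grid_point a dx i))) j
      - divergence (\<lambda>y. mob P (v t y) *\<^sub>R grad (\<lambda>z. gam P * laplacian (v t) z - pot P (v t z)) y)
          (grid_point a dx j)\<bar> \<le> C * dx"
proof -
  define I :: "(nat \<times> real) set" where "I = {0<..} \<times> {0..T}"
  define L where "L = b - a"
  define h :: "nat \<times> real \<Rightarrow> real" where "h i = L / real (fst i)" for i
  have Lpos: "L > 0" using assms(1) by (simp add: L_def)
  interpret mesh_family I L h L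
  proof
    fix i assume i: "i \<in> I"
    then show "h i > 0" using Lpos by (auto simp: I_def h_def)
    show "h i \<le> L" using i Lpos by (auto simp: I_def h_def divide_le_eq)
  qed
  note st = assms(2)[unfolded standing_assumptions_def]
  define V where "V i x = v (snd i) x" for i :: "nat \<times> real" and x
  define M where "M i x = mob P (V i x)" for i :: "nat \<times> real" and x
  define \<mu> where "\<mu> i x = gam P * mesh_lap V i x - pot P (V i x)" for i x
  define \<mu>0 where "\<mu>0 i x = gam P * laplacian (V i) x - pot P (V i x)" for i x
  have "smooth_family I (b - a) (\<lambda>i x. case (snd i, x) of (t, x) \<Rightarrow> v t x)"
    using assms(1) by (intro strip_smooth_family[OF v(1,2)]) (auto simp: I_def)
  then have V: "smooth V" by (simp add: V_def[abs_def] L_def)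
  have smooth_coeffs: "smooth_on UNIV (mob P)" "smooth_on UNIV (pot P)" using st by auto
  have M: "smooth M" unfolding M_def by (rule smooth_family_compose[OF smooth_coeffs(1) V])
  have Mpos: "M i x > 0" for i x using st by (simp add: M_def)
  have "approx \<mu> \<mu>0"
    unfolding \<mu>_def \<mu>0_def
    by (intro approx_diff approx_cmult approx_mesh_lap approx_refl V smooth_family_compose[OF smooth_coeffs(2) V])
  then have g: "approx (forward_diff \<alpha> \<mu>) (\<lambda>i. pderiv_at \<alpha> (\<mu>0 i))" for \<alpha> by (rule approx_forward_diff)
  \<comment> \<open>The residual has order \<open>d + 2\<close>, as the loss in \<open>flux_op_small_rhs\<close> requires.\<close>
  obtain Q \<rho> where Q: "\<And>\<alpha>. approx (Q \<alpha>) (\<lambda>i x. M i x * pderiv_at \<alpha> (\<mu>0 i) x)"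
    and \<rho>: "\<And>\<alpha>. smooth (\<rho> \<alpha>)"
    and eq: "\<And>\<alpha> i x. i \<in> I \<Longrightarrow> Q \<alpha> i x / M i x - h i * regularisation (cq P) (cw P) Q \<alpha> i x
      = forward_diff \<alpha> \<mu> i x + h i ^ Suc (CARD('d) + 1) * \<rho> \<alpha> i x"
    using defect_correction[where c = "cq P" and c' = "cw P" and K = "CARD('d) + 1"
        and g = "\<lambda>\<alpha>. forward_diff \<alpha> \<mu>" and ?g0.0 = "\<lambda>\<alpha> i. pderiv_at \<alpha> (\<mu>0 i)", OF M Mpos g] by blast
  define F0 where "F0 i x = (\<chi> \<alpha>. M i x * pderiv_at \<alpha> (\<mu>0 i) x)" for i x
  have "approx (mesh_div Q) (\<lambda>i. divergence (F0 i))"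
    by (rule approx_mesh_div) (simp add: F0_def Q)
  then obtain S where S: "smooth S" "\<And>i x. i \<in> I \<Longrightarrow> mesh_div Q i x = divergence (F0 i) x + h i * S i x"
    using approxE by metis
  obtain BS where BS: "BS > 0" "\<And>i x. i \<in> I \<Longrightarrow> \<bar>S i x\<bar> \<le> BS" using smooth_family_bound[OF S(1)] by metis
  obtain BM where BM: "\<And>i x. i \<in> I \<Longrightarrow> \<bar>M i x\<bar> \<le> BM" using smooth_family_bound[OF M] by metis
  have "\<forall>\<alpha>. \<exists>B. \<forall>i\<in>I. \<forall>x. \<bar>\<rho> \<alpha> i x\<bar> \<le> B"
    using smooth_family_bounded_periodic[OF \<rho>] by (simp add: bounded_periodic_def)
  then obtain B\<rho> where B\<rho>: "\<And>\<alpha> i x. i \<in> I \<Longrightarrow> \<bar>\<rho> \<alpha> i x\<bar> \<le> B\<rho> \<alpha>" by metis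
  define R where "R = Max (range B\<rho>)"
  have R: "\<bar>\<rho> \<alpha> i x\<bar> \<le> R" if "i \<in> I" for \<alpha> i x
    using B\<rho>[OF that] unfolding R_def by (rule order_trans) simp
  define E where "E = BM * R * sqrt CARD('d) * L ^ CARD('d)"
  define C where "C = 2 * real CARD('d) * E + BS"
  have "\<bar>div_h (h i) (flux P (h i) N (\<lambda>j. V i (grid_point a (h i) j))) j
      - divergence (F0 i) (grid_point a (h i) j)\<bar> \<le> C * h i" if i: "i = (N, t)" "i \<in> I" for i N t j
  proof -
    let ?gp = "grid_point a (h i)"
    let ?q = "\<lambda>j. \<chi> \<alpha>. Q \<alpha> i (?gp j)"
    let ?fl = "flux P (h i) N (\<lambda>j. V i (?gp j))"
    have N: "N > 0" and NL: "real N * h i = L" and hpos: "h i > 0"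
      using i h_pos by (auto simp: I_def h_def)
    have c: "cq P > 0" "cw P > 0" using st by auto
    have per: "F i (x + axis \<alpha> L) = F i x" if "smooth F" for F :: "nat \<times> real \<Rightarrow> real^'d \<Rightarrow> real" and x \<alpha>
      by (rule smooth_family_periodic[OF that i(2)])
    have uper: "grid_periodic N (\<lambda>j. V i (?gp j))"
      by (rule grid_periodic_restrict[OF per[OF V] NL])
    have qper: "grid_periodic N ?q"
      by (rule grid_periodic_restrict[where f = "\<lambda>x. \<chi> \<alpha>. Q \<alpha> i x", OF _ NL])
        (simp add: per[OF approx_smooth[OF Q]])
    note fl = flux_solves(1,2)[OF assms(2) N hpos uper]
    \<comment> \<open>The flux error solves the flux equation with minus the residual as right-hand side.\<close>
    define e where "e j = (- 1) *\<^sub>R ?q j + ?fl j" for j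
    have eper: "grid_periodic N e" using qper fl(1) by (simp add: grid_periodic_def e_def)
    have rhs: "grad_h (h i) (\<lambda>j. gam P * lap_h (h i) (\<lambda>j. V i (?gp j)) j - pot P (V i (?gp j)))
        = (\<lambda>j. \<chi> \<alpha>. forward_diff \<alpha> \<mu> i (?gp j))"
      using grad_h_restrict[of i \<mu> a] by (simp add: lap_h_restrict \<mu>_def)
    have op_q: "flux_op P (h i) (\<lambda>j. M i (?gp j)) ?q j
        = (\<chi> \<alpha>. forward_diff \<alpha> \<mu> i (?gp j) + h i ^ Suc (CARD('d) + 1) * \<rho> \<alpha> i (?gp j))" for j
      unfolding flux_op_restrict eq[OF i(2)] ..
    have op_fl: "flux_op P (h i) (\<lambda>j. M i (?gp j)) ?fl = (\<lambda>j. \<chi> \<alpha>. forward_diff \<alpha> \<mu> i (?gp j))"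
      using fl(2) by (simp only: rhs M_def)
    have "flux_op P (h i) (\<lambda>j. M i (?gp j)) e
        = (\<lambda>j. (- 1) *\<^sub>R flux_op P (h i) (\<lambda>j. M i (?gp j)) ?q j + flux_op P (h i) (\<lambda>j. M i (?gp j)) ?fl j)"
      unfolding e_def[abs_def] by (rule flux_op_linear)
    then have op_e: "flux_op P (h i) (\<lambda>j. M i (?gp j)) e j $ \<alpha> = - (h i ^ (CARD('d) + 2)) * \<rho> \<alpha> i (?gp j)" for j \<alpha>
      by (simp add: op_q op_fl)
    have e_le: "\<bar>e j $ \<alpha>\<bar> \<le> E * (h i)\<^sup>2" for j \<alpha>
      unfolding E_def
    proof (rule flux_op_small_rhs[OF eper N hpos c NL])
      show "M i (?gp j) > 0" "M i (?gp j) \<le> BM" for j using Mpos BM[OF i(2)] abs_le_D1 by blast+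
      show "\<bar>flux_op P (h i) (\<lambda>j. M i (?gp j)) e j $ \<alpha>\<bar> \<le> R * h i ^ (CARD('d) + 2)" for j \<alpha>
        using mult_right_mono[OF R[OF i(2), of \<alpha> "?gp j"], of "h i ^ (CARD('d) + 2)"] hpos
        unfolding op_e by (simp add: abs_mult mult.commute)
    qed
    have "div_h (h i) e j = - div_h (h i) ?q j + div_h (h i) ?fl j"
      using div_h_linear[of "h i" "-1" ?q ?fl] by (simp add: e_def[abs_def])
    then have "div_h (h i) ?fl j - divergence (F0 i) (?gp j) = div_h (h i) e j + h i * S i (?gp j)"
      by (simp add: div_h_restrict S(2)[OF i(2)])
    moreover have "\<bar>h i * S i (?gp j)\<bar> \<le> h i * BS"
      using BS(2)[OF i(2)] hpos by (simp add: abs_mult)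
    ultimately show ?thesis
      using div_h_le[of e E "h i" j, OF e_le hpos] abs_triangle_ineq[of "div_h (h i) e j" "h i * S i (?gp j)"]
      by (simp add: C_def algebra_simps)
  qed
  note bound = this
  have "\<bar>div_h (L / real N) (flux P (L / real N) N (\<lambda>i. v t (grid_point a (L / real N) i))) j
      - divergence (\<lambda>y. mob P (v t y) *\<^sub>R grad (\<lambda>z. gam P * laplacian (v t) z - pot P (v t z)) y)
          (grid_point a (L / real N) j)\<bar> \<le> max C 1 * (L / real N)" if N: "N > 0" and t: "t \<in> {0..T}" for N t j
  proof -
    have F0: "F0 (N, t) = (\<lambda>y. mob P (v t y) *\<^sub>R grad (\<lambda>z. gam P * laplacian (v t) z - pot P (v t z)) y)"
      by (simp add: F0_def M_def \<mu>0_def[abs_def] V_def[abs_def] grad_def fun_eq_iff vec_eq_iff)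
    have "\<bar>div_h (L / real N) (flux P (L / real N) N (\<lambda>i. v t (grid_point a (L / real N) i))) j
      - divergence (F0 (N, t)) (grid_point a (L / real N) j)\<bar> \<le> C * (L / real N)"
      using bound[of "(N, t)" N t j] N t by (simp add: I_def h_def V_def)
    also have "\<dots> \<le> max C 1 * (L / real N)" using Lpos by (intro mult_right_mono) auto
    finally show ?thesis unfolding F0 .
  qed
  then show ?thesis unfolding Let_def L_def by (intro exI[of _ "max C 1"]) auto
qed

definition limit_scheme :: "model \<Rightarrow> real \<Rightarrow> real \<Rightarrow> ('d::finite) one_step" where
  "limit_scheme P a b N dt u j = (let dx = (b - a) / real N in u j - dt * div_h dx (flux P dx N u) j)"

lemma limit_scheme_consistent:
  assumes "a < b" "standing_assumptions P"
  shows "consistent P a b (limit_scheme P a b :: ('d::finite) one_step)"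
  unfolding consistent_def
proof (intro allI impI)
  fix T \<eta> :: real and v :: "real \<Rightarrow> real^'d \<Rightarrow> real"
  assume "T > 0 \<and> smooth_positive_solution P a b T v" and "\<eta> > 0"
  then have T: "T > 0" and sol: "smooth_positive_solution P a b T v" by auto
  then obtain S where S: "{0..T} \<subseteq> S" "strip_smooth S T (b - a) (\<lambda>(t, x). v t x)"
    by (auto simp: smooth_positive_solution_def strip_smooth_def)
  let ?F = "\<lambda>t y. mob P (v t y) *\<^sub>R grad (\<lambda>z. gam P * laplacian (v t) z - pot P (v t z)) y"
  obtain C where C: "C > 0" "\<And>N t j. N > 0 \<Longrightarrow> t \<in> {0..T} \<Longrightarrow> let dx = (b - a) / real N in
    \<bar>div_h dx (flux P dx N (\<lambda>i. v t (grid_point a dx i))) j - divergence (?F t) (grid_point a dx j)\<bar> \<le> C * dx"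
    using flux_divergence_consistent[OF assms T S(2,1)] by blast
  obtain B where B: "B > 0" "\<And>t x dt. 0 < dt \<Longrightarrow> t \<in> {0..T - dt} \<Longrightarrow>
    \<bar>(v (t + dt) x - v t x) / dt - deriv (\<lambda>t. v t x) t\<bar> \<le> B * dt"
    using forward_difference_time[OF S(2,1) _ T] assms(1) by auto
  have err: "\<bar>truncation_error a b (limit_scheme P a b) v N dt t j\<bar> \<le> B * dt + C * ((b - a) / real N)"
    if N: "N > 0" and dt: "dt > 0" and t: "t \<in> {0..T - dt}" for N dt t j
  proof -
    define dx where "dx = (b - a) / real N"
    let ?x = "grid_point a dx j"
    let ?d = "div_h dx (flux P dx N (\<lambda>i. v t (grid_point a dx i))) j"
    have "truncation_error a b (limit_scheme P a b) v N dt t j = (v (t + dt) ?x - v t ?x) / dt + ?d"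
      using dt by (simp add: truncation_error_def limit_scheme_def Let_def dx_def[symmetric] field_simps)
    moreover have "t \<in> {0..T}" using t dt by auto
    then have "deriv (\<lambda>t. v t ?x) t + divergence (?F t) ?x = 0"
      using sol by (simp add: smooth_positive_solution_def)
    moreover have "\<bar>?d - divergence (?F t) ?x\<bar> \<le> C * dx"
      using C(2)[OF N \<open>t \<in> {0..T}\<close>, of j] by (simp add: dx_def Let_def)
    ultimately show ?thesis using B(2)[OF dt t, of ?x] unfolding dx_def[symmetric] by linarith
  qed
  have "(\<lambda>N. C * ((b - a) / real N)) \<longlonglongrightarrow> 0" 
    by (intro tendsto_mult_right_zero lim_const_over_n)
  then have "\<forall>\<^sub>F N in sequentially. C * ((b - a) / real N) < \<eta> / 2"
    by (rule order_tendstoD) (use \<open>\<eta> > 0\<close> in simp)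
  then have eN: "\<forall>\<^sub>F N in sequentially. N > 0 \<and> C * ((b - a) / real N) < \<eta> / 2"
    using eventually_gt_at_top by (rule eventually_conj[rotated])
  have "((\<lambda>dt. B * dt) \<longlongrightarrow> 0) (at_right 0)" by (auto intro!: tendsto_eq_intros)
  then have "\<forall>\<^sub>F dt in at_right 0. B * dt < \<eta> / 2"
    by (rule order_tendstoD) (use \<open>\<eta> > 0\<close> in simp)
  then have edt: "\<forall>\<^sub>F dt in at_right 0. dt > 0 \<and> B * dt < \<eta> / 2"
    using eventually_at_right_less by (rule eventually_conj[rotated])
  show "\<forall>\<^sub>F (N, dt) in sequentially \<times>\<^sub>F at_right 0.
    \<forall>t\<in>{0..T - dt}. \<forall>j. \<bar>truncation_error a b (limit_scheme P a b) v N dt t j\<bar> < \<eta>"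
    unfolding eventually_prod_filter
  proof (intro exI conjI allI impI)
    show "case (N, dt) of (N, dt) \<Rightarrow> \<forall>t\<in>{0..T - dt}. \<forall>j. \<bar>truncation_error a b (limit_scheme P a b) v N dt t j\<bar> < \<eta>"
      if "N > 0 \<and> C * ((b - a) / real N) < \<eta> / 2" "dt > 0 \<and> B * dt < \<eta> / 2" for N dt
    proof (clarsimp split del: if_split)
      fix t j assume "0 \<le> t" "t \<le> T - dt"
      then show "\<bar>truncation_error a b (limit_scheme P a b) v N dt t j\<bar> < \<eta>"
        using err[of N dt t j] that by (smt (verit) atLeastAtMost_iff field_sum_of_halves)
    qed
  qed (rule eN, rule edt)
qed

section \<open>The relaxation limit\<close>

lemma bigo_id_tendsto_zero:
  fixes f :: "real \<Rightarrow> real"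
  assumes "f \<in> O[at_right 0](\<lambda>\<epsilon>. \<epsilon>)"
  shows "(f \<longlongrightarrow> 0) (at_right 0)"
proof -
  obtain c where "\<forall>\<^sub>F \<epsilon> in at_right 0. norm (f \<epsilon>) \<le> c * norm \<epsilon>"
    using landau_o.bigE[OF assms] by blast
  moreover have "((\<lambda>\<epsilon>::real. c * norm \<epsilon>) \<longlongrightarrow> 0) (at_right 0)" by (auto intro!: tendsto_eq_intros)
  ultimately show ?thesis by (rule Lim_null_comparison)
qed

lemma has_expansion_tendsto:
  assumes "has_expansion f c"
  shows "(f \<longlongrightarrow> c 0) (at_right 0)"
proof -
  have "(\<lambda>\<epsilon>. norm (f \<epsilon> - (\<Sum>k<1. \<epsilon> ^ k *\<^sub>R c k))) \<in> O[at_right 0](\<lambda>\<epsilon>. \<epsilon> ^ 1)"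
    using assms unfolding has_expansion_def by blast
  then have "((\<lambda>\<epsilon>. norm (f \<epsilon> - c 0)) \<longlongrightarrow> 0) (at_right 0)"
    by (intro bigo_id_tendsto_zero) simp
  then show ?thesis by (simp add: tendsto_norm_zero_iff LIM_zero_iff)
qed

lemma tendsto_D_minus:
  "(\<And>j. ((\<lambda>\<epsilon>. f \<epsilon> j) \<longlongrightarrow> g j) F) \<Longrightarrow> ((\<lambda>\<epsilon>. D_minus dx \<alpha> (f \<epsilon>) j) \<longlongrightarrow> D_minus dx \<alpha> g j) F"
  unfolding D_minus_def divide_inverse by (intro tendsto_intros)

lemma tendsto_grad_h:
  "(\<And>j. ((\<lambda>\<epsilon>. f \<epsilon> j) \<longlongrightarrow> g j) F) \<Longrightarrow> ((\<lambda>\<epsilon>. grad_h dx (f \<epsilon>) j) \<longlongrightarrow> grad_h dx g j) F"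
  unfolding grad_h_def D_plus_def divide_inverse by (intro tendsto_intros)

lemma tendsto_div_h:
  "(\<And>j. ((\<lambda>\<epsilon>. v \<epsilon> j) \<longlongrightarrow> w j) F) \<Longrightarrow> ((\<lambda>\<epsilon>. div_h dx (v \<epsilon>) j) \<longlongrightarrow> div_h dx w j) F"
  unfolding div_h_def by (intro tendsto_sum tendsto_D_minus tendsto_vec_nth)

lemma tendsto_lap_h:
  "(\<And>j. ((\<lambda>\<epsilon>. f \<epsilon> j) \<longlongrightarrow> g j) F) \<Longrightarrow> ((\<lambda>\<epsilon>. lap_h dx (f \<epsilon>) j) \<longlongrightarrow> lap_h dx g j) F"
  unfolding lap_h_def by (intro tendsto_div_h tendsto_grad_h)

lemma tendsto_vlap_h:
  "(\<And>j. ((\<lambda>\<epsilon>. v \<epsilon> j) \<longlongrightarrow> w j) F) \<Longrightarrow> ((\<lambda>\<epsilon>. vlap_h dx (v \<epsilon>) j) \<longlongrightarrow> vlap_h dx w j) F"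
  unfolding vlap_h_def by (intro tendsto_vec_lambda tendsto_lap_h tendsto_vec_nth)

lemma grid_periodic_limit:
  fixes f :: "real \<Rightarrow> int^'d::finite \<Rightarrow> 'b::t2_space"
  assumes "\<And>j. ((\<lambda>\<epsilon>. f \<epsilon> j) \<longlongrightarrow> g j) (at_right 0)" "\<forall>\<^sub>F \<epsilon> in at_right 0. grid_periodic N (f \<epsilon>)"
  shows "grid_periodic N g"
  unfolding grid_periodic_def
proof (intro allI)
  fix j :: "int^'d" and \<alpha>
  have "\<forall>\<^sub>F \<epsilon> in at_right 0. f \<epsilon> (j + axis \<alpha> (int N)) = f \<epsilon> j"
    using assms(2) by eventually_elim (simp add: grid_periodic_def)
  from Lim_transform_eventually[OF assms(1) this]
  show "g (j + axis \<alpha> (int N)) = g j"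
    using assms(1) by (rule tendsto_unique[OF trivial_limit_at_right_real])
qed

text \<open>The stiff equations, multiplied by \<open>\<epsilon>\<close>, in a form whose limit can be taken termwise.\<close>

lemma predictor_solved:
  assumes "predictor P dx dt \<epsilon> X Y" "\<epsilon> > 0" "dt > 0"
  shows "st_u Y = st_u X" and "st_p Y = st_p X"
    and "st_w Y j + (1 - \<epsilon>) * div_h dx (st_q Y) j = - \<epsilon> * ((st_psi Y j - st_psi X j) / dt)"
    and "(1 / mob P (st_u X j)) *\<^sub>R st_q Y j
          + (1 - \<epsilon>) *\<^sub>R grad_h dx (\<lambda>i. pot P (st_u X i) + st_psi Y i) j
          - (cq P * dx) *\<^sub>R vlap_h dx (st_q Y) j = - (\<epsilon> / dt) *\<^sub>R (st_q Y j - st_q X j)"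
    and "st_psi Y j = \<epsilon> * ((st_w Y j - st_w X j) / dt) - gam P * (1 - \<epsilon>) * div_h dx (st_p X) j
          - cw P * dx * lap_h dx (st_w Y) j"
proof -
  note eqs = assms(1)[unfolded predictor_def Let_def, rule_format]
  show u: "st_u Y = st_u X" and p: "st_p Y = st_p X"
    using eqs \<open>dt > 0\<close> by (auto simp: fun_eq_iff)
  show "st_w Y j + (1 - \<epsilon>) * div_h dx (st_q Y) j = - \<epsilon> * ((st_psi Y j - st_psi X j) / dt)"
    using eqs[of j] \<open>\<epsilon> > 0\<close> by simp
  show "st_psi Y j = \<epsilon> * ((st_w Y j - st_w X j) / dt) - gam P * (1 - \<epsilon>) * div_h dx (st_p X) j
          - cw P * dx * lap_h dx (st_w Y) j"
    using eqs[of j] \<open>\<epsilon> > 0\<close> by (simp add: p)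
  define A where "A = (1 / mob P (st_u X j)) *\<^sub>R st_q Y j
          + (1 - \<epsilon>) *\<^sub>R grad_h dx (\<lambda>i. pot P (st_u X i) + st_psi Y i) j
          - (cq P * dx) *\<^sub>R vlap_h dx (st_q Y) j"
  have "(1 / dt) *\<^sub>R (st_q Y j - st_q X j) = - (1 / \<epsilon>) *\<^sub>R A"
    using eqs[of j] unfolding A_def u by blast
  then have "- \<epsilon> *\<^sub>R ((1 / dt) *\<^sub>R (st_q Y j - st_q X j)) = - \<epsilon> *\<^sub>R (- (1 / \<epsilon>) *\<^sub>R A)" by (simp only:)
  then have "A = - (\<epsilon> / dt) *\<^sub>R (st_q Y j - st_q X j)" using \<open>\<epsilon> > 0\<close> by simp
  then show "(1 / mob P (st_u X j)) *\<^sub>R st_q Y j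
          + (1 - \<epsilon>) *\<^sub>R grad_h dx (\<lambda>i. pot P (st_u X i) + st_psi Y i) j
          - (cq P * dx) *\<^sub>R vlap_h dx (st_q Y) j = - (\<epsilon> / dt) *\<^sub>R (st_q Y j - st_q X j)"
    by (simp only: A_def)
qed

lemma corrector_solved:
  assumes "corrector P dx dt \<epsilon> Y Z" "dt > 0"
  shows "st_u Z j = st_u Y j - dt * div_h dx (st_q Y) j + \<epsilon> * (dt * cu P * dt * lap_h dx (\<lambda>i. pot P (st_u Y i)) j)"
    and "st_q Y j = st_q Z j + dt *\<^sub>R grad_h dx (\<lambda>i. pot P (st_u Y i) + st_psi Y i) j"
    and "st_w Y j = st_w Z j - dt * gam P * div_h dx (st_p Y) j"
proof -
  note eqs = assms(1)[unfolded corrector_def Let_def, rule_format, of j]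
  show "st_u Z j = st_u Y j - dt * div_h dx (st_q Y) j + \<epsilon> * (dt * cu P * dt * lap_h dx (\<lambda>i. pot P (st_u Y i)) j)"
    using eqs \<open>dt > 0\<close> by (simp add: field_simps)
  show "st_w Y j = st_w Z j - dt * gam P * div_h dx (st_p Y) j"
    using eqs \<open>dt > 0\<close> by (simp add: field_simps)
  have "dt *\<^sub>R ((1 / dt) *\<^sub>R (st_q Z j - st_q Y j) + grad_h dx (\<lambda>i. pot P (st_u Y i) + st_psi Y i) j) = 0"
    using eqs by simp
  then show "st_q Y j = st_q Z j + dt *\<^sub>R grad_h dx (\<lambda>i. pot P (st_u Y i) + st_psi Y i) j"
    using \<open>dt > 0\<close> by (simp add: scaleR_right_distrib algebra_simps)
qed

text \<open>The limits of \<open>w\<^sup>*\<close>, \<open>\<psi>\<^sup>*\<close> and \<open>\<^bold>q\<^sup>*\<close> are read off in this order, each from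
  an equation in which the unknown appears without a factor that degenerates as \<open>\<epsilon>\<close> tends to 0.\<close>

lemma relaxation_limit:
  fixes U :: "real \<Rightarrow> nat \<Rightarrow> ('d::finite) state"
  assumes "a < b" "standing_assumptions P" "N > 0" "dt > 0"
    and sol: "discrete_solution P N ((b - a) / real N) dt U V"
    and expn: "\<And>m. state_expansion (\<lambda>\<epsilon>. U \<epsilon> m) (C m)"
    and wp: "well_prepared P N ((b - a) / real N) (\<lambda>\<epsilon>. U \<epsilon> n)"
  shows "st_u (C (Suc n) 0) = limit_scheme P a b N dt (st_u (C n 0))"
proof -
  define dx where "dx = (b - a) / real N"
  have dx: "dx > 0" using assms(1,3) by (simp add: dx_def)
  let ?F = "at_right (0::real)"
  define X where "X \<epsilon> = U \<epsilon> n" for \<epsilon>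
  define Y where "Y \<epsilon> = V \<epsilon> n" for \<epsilon>
  define Z where "Z \<epsilon> = U \<epsilon> (Suc n)" for \<epsilon>
  define u where "u = st_u (C n 0)"
  have ev: "\<forall>\<^sub>F \<epsilon> in ?F. \<epsilon> \<in> {0<..1::real}"
    using eventually_at_right_real[of 0 1] by (auto elim: eventually_mono)
  have step: "state_periodic N (X \<epsilon>)" "state_periodic N (Y \<epsilon>)" "predictor P dx dt \<epsilon> (X \<epsilon>) (Y \<epsilon>)"
    "corrector P dx dt \<epsilon> (Y \<epsilon>) (Z \<epsilon>)" if "\<epsilon> \<in> {0<..1}" for \<epsilon>
    using sol that unfolding discrete_solution_def X_def Y_def Z_def dx_def by blast+
  have pos: "\<epsilon> > 0" if "\<epsilon> \<in> {0<..1}" for \<epsilon> :: real using that by simp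
  note pred = predictor_solved[OF step(3) pos \<open>dt > 0\<close>]
  note corr = corrector_solved[OF step(4) \<open>dt > 0\<close>]
  have eps: "((\<lambda>\<epsilon>. \<epsilon>) \<longlongrightarrow> 0) ?F" by (rule tendsto_ident_at)
  have X: "((\<lambda>\<epsilon>. st_u (X \<epsilon>) j) \<longlongrightarrow> u j) ?F" "((\<lambda>\<epsilon>. st_psi (X \<epsilon>) j) \<longlongrightarrow> st_psi (C n 0) j) ?F"
    "((\<lambda>\<epsilon>. st_q (X \<epsilon>) j) \<longlongrightarrow> st_q (C n 0) j) ?F" "((\<lambda>\<epsilon>. st_w (X \<epsilon>) j) \<longlongrightarrow> st_w (C n 0) j) ?F"
    "((\<lambda>\<epsilon>. st_p (X \<epsilon>) j) \<longlongrightarrow> st_p (C n 0) j) ?F" for j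
    using expn[of n] unfolding state_expansion_def X_def u_def by (auto dest: has_expansion_tendsto)
  have Z: "((\<lambda>\<epsilon>. st_u (Z \<epsilon>) j) \<longlongrightarrow> st_u (C (Suc n) 0) j) ?F"
    "((\<lambda>\<epsilon>. st_q (Z \<epsilon>) j) \<longlongrightarrow> st_q (C (Suc n) 0) j) ?F"
    "((\<lambda>\<epsilon>. st_w (Z \<epsilon>) j) \<longlongrightarrow> st_w (C (Suc n) 0) j) ?F" for j
    using expn[of "Suc n"] unfolding state_expansion_def Z_def by (auto dest: has_expansion_tendsto)
  have u_per: "grid_periodic N u"
  proof (rule grid_periodic_limit[OF X(1)])
    show "\<forall>\<^sub>F \<epsilon> in ?F. grid_periodic N (st_u (X \<epsilon>))"
      using ev by eventually_elim (use step(1) in \<open>simp add: state_periodic_def\<close>)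
  qed
  have p0: "st_p (C n 0) = grad_h dx u"
  proof
    fix j
    have "((\<lambda>\<epsilon>. norm (st_p (X \<epsilon>) j - grad_h dx (st_u (X \<epsilon>)) j)) \<longlongrightarrow> 0) ?F"
      using wp unfolding well_prepared_def X_def dx_def by (intro bigo_id_tendsto_zero) blast
    moreover have "((\<lambda>\<epsilon>. norm (st_p (X \<epsilon>) j - grad_h dx (st_u (X \<epsilon>)) j)) \<longlongrightarrow> norm (st_p (C n 0) j - grad_h dx u j)) ?F"
      by (intro tendsto_norm tendsto_diff X tendsto_grad_h)
    ultimately have "norm (st_p (C n 0) j - grad_h dx u j) = 0"
      using tendsto_unique[OF trivial_limit_at_right_real] by blast
    then show "st_p (C n 0) j = grad_h dx u j" by simp
  qed
  have "smooth_on UNIV (mob P)" "smooth_on UNIV (pot P)" and mpos: "\<And>y. mob P y > 0"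
    using assms(2) by (auto simp: standing_assumptions_def)
  then have cont: "isCont (mob P) y" "isCont (pot P) y" for y
    using smooth_on_continuous[of UNIV "mob P"] smooth_on_continuous[of UNIV "pot P"] by (auto simp: continuous_on_eq_continuous_at)
  have pot_lim: "((\<lambda>\<epsilon>. pot P (st_u (X \<epsilon>) j)) \<longlongrightarrow> pot P (u j)) ?F" for j
    by (rule isCont_tendsto_compose[OF cont(2) X(1)])
  have mob_lim: "((\<lambda>\<epsilon>. mob P (st_u (X \<epsilon>) j)) \<longlongrightarrow> mob P (u j)) ?F" for j
    by (rule isCont_tendsto_compose[OF cont(1) X(1)])

  define w where "w j = st_w (C (Suc n) 0) j - dt * gam P * div_h dx (st_p (C n 0)) j" for j
  have w_lim: "((\<lambda>\<epsilon>. st_w (Y \<epsilon>) j) \<longlongrightarrow> w j) ?F" for j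
  proof (rule Lim_transform_eventually)
    show "((\<lambda>\<epsilon>. st_w (Z \<epsilon>) j - dt * gam P * div_h dx (st_p (X \<epsilon>)) j) \<longlongrightarrow> w j) ?F"
      unfolding w_def by (intro tendsto_intros tendsto_div_h X Z)
    show "\<forall>\<^sub>F \<epsilon> in ?F. st_w (Z \<epsilon>) j - dt * gam P * div_h dx (st_p (X \<epsilon>)) j = st_w (Y \<epsilon>) j"
      using ev by eventually_elim (simp add: corr(3) pred(2))
  qed
  define \<psi> where "\<psi> j = - gam P * lap_h dx u j - cw P * dx * lap_h dx w j" for j
  have \<psi>_lim: "((\<lambda>\<epsilon>. st_psi (Y \<epsilon>) j) \<longlongrightarrow> \<psi> j) ?F" for j
  proof (rule Lim_transform_eventually)
    have "((\<lambda>\<epsilon>. \<epsilon> * ((st_w (Y \<epsilon>) j - st_w (X \<epsilon>) j) * (1 / dt)) - gam P * (1 - \<epsilon>) * div_h dx (st_p (X \<epsilon>)) j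
          - cw P * dx * lap_h dx (st_w (Y \<epsilon>)) j)
      \<longlongrightarrow> 0 * ((w j - st_w (C n 0) j) * (1 / dt)) - gam P * (1 - 0) * div_h dx (st_p (C n 0)) j
          - cw P * dx * lap_h dx w j) ?F"
      by (intro tendsto_diff tendsto_mult tendsto_const eps w_lim X tendsto_div_h tendsto_lap_h)
    then show "((\<lambda>\<epsilon>. \<epsilon> * ((st_w (Y \<epsilon>) j - st_w (X \<epsilon>) j) / dt) - gam P * (1 - \<epsilon>) * div_h dx (st_p (X \<epsilon>)) j
          - cw P * dx * lap_h dx (st_w (Y \<epsilon>)) j) \<longlongrightarrow> \<psi> j) ?F"
      by (simp add: \<psi>_def p0 lap_h_def)
    show "\<forall>\<^sub>F \<epsilon> in ?F. \<epsilon> * ((st_w (Y \<epsilon>) j - st_w (X \<epsilon>) j) / dt) - gam P * (1 - \<epsilon>) * div_h dx (st_p (X \<epsilon>)) j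
          - cw P * dx * lap_h dx (st_w (Y \<epsilon>)) j = st_psi (Y \<epsilon>) j"
      using ev by eventually_elim (simp only: pred(5)[symmetric])
  qed
  have chem_lim: "((\<lambda>\<epsilon>. grad_h dx (\<lambda>i. pot P (st_u (X \<epsilon>) i) + st_psi (Y \<epsilon>) i) j)
      \<longlongrightarrow> grad_h dx (\<lambda>i. pot P (u i) + \<psi> i) j) ?F" for j
    by (intro tendsto_grad_h tendsto_add pot_lim \<psi>_lim)
  define q where "q j = st_q (C (Suc n) 0) j + dt *\<^sub>R grad_h dx (\<lambda>i. pot P (u i) + \<psi> i) j" for j
  have q_lim: "((\<lambda>\<epsilon>. st_q (Y \<epsilon>) j) \<longlongrightarrow> q j) ?F" for j
  proof (rule Lim_transform_eventually)
    show "((\<lambda>\<epsilon>. st_q (Z \<epsilon>) j + dt *\<^sub>R grad_h dx (\<lambda>i. pot P (st_u (X \<epsilon>) i) + st_psi (Y \<epsilon>) i) j) \<longlongrightarrow> q j) ?F"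
      unfolding q_def by (intro tendsto_intros chem_lim Z)
    show "\<forall>\<^sub>F \<epsilon> in ?F. st_q (Z \<epsilon>) j + dt *\<^sub>R grad_h dx (\<lambda>i. pot P (st_u (X \<epsilon>) i) + st_psi (Y \<epsilon>) i) j = st_q (Y \<epsilon>) j"
      using ev by eventually_elim (simp add: corr(2) pred(1))
  qed

  have w_q: "w j = - div_h dx q j" for j
  proof -
    have "((\<lambda>\<epsilon>. st_w (Y \<epsilon>) j + (1 - \<epsilon>) * div_h dx (st_q (Y \<epsilon>)) j) \<longlongrightarrow> w j + (1 - 0) * div_h dx q j) ?F"
      by (intro tendsto_intros eps w_lim tendsto_div_h q_lim)
    moreover have "((\<lambda>\<epsilon>. st_w (Y \<epsilon>) j + (1 - \<epsilon>) * div_h dx (st_q (Y \<epsilon>)) j) \<longlongrightarrow> 0) ?F"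
    proof (rule Lim_transform_eventually)
      have "((\<lambda>\<epsilon>. - \<epsilon> * ((st_psi (Y \<epsilon>) j - st_psi (X \<epsilon>) j) * (1 / dt))) \<longlongrightarrow> - 0 * ((\<psi> j - st_psi (C n 0) j) * (1 / dt))) ?F"
        by (intro tendsto_mult tendsto_minus tendsto_diff tendsto_const eps \<psi>_lim X)
      then show "((\<lambda>\<epsilon>. - \<epsilon> * ((st_psi (Y \<epsilon>) j - st_psi (X \<epsilon>) j) / dt)) \<longlongrightarrow> 0) ?F" by simp
      show "\<forall>\<^sub>F \<epsilon> in ?F. - \<epsilon> * ((st_psi (Y \<epsilon>) j - st_psi (X \<epsilon>) j) / dt) = st_w (Y \<epsilon>) j + (1 - \<epsilon>) * div_h dx (st_q (Y \<epsilon>)) j"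
        using ev by eventually_elim (simp only: pred(3))
    qed
    ultimately have "w j + (1 - 0) * div_h dx q j = 0" by (rule tendsto_unique[OF trivial_limit_at_right_real])
    then show ?thesis by simp
  qed
  have q_eq: "(1 / mob P (u j)) *\<^sub>R q j + grad_h dx (\<lambda>i. pot P (u i) + \<psi> i) j - (cq P * dx) *\<^sub>R vlap_h dx q j = 0" for j
  proof -
    have "((\<lambda>\<epsilon>. (1 / mob P (st_u (X \<epsilon>) j)) *\<^sub>R st_q (Y \<epsilon>) j
          + (1 - \<epsilon>) *\<^sub>R grad_h dx (\<lambda>i. pot P (st_u (X \<epsilon>) i) + st_psi (Y \<epsilon>) i) j
          - (cq P * dx) *\<^sub>R vlap_h dx (st_q (Y \<epsilon>)) j)
       \<longlongrightarrow> (1 / mob P (u j)) *\<^sub>R q j + (1 - 0) *\<^sub>R grad_h dx (\<lambda>i. pot P (u i) + \<psi> i) j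
          - (cq P * dx) *\<^sub>R vlap_h dx q j) ?F"
      using mpos[of "u j"] by (intro tendsto_intros eps mob_lim chem_lim tendsto_vlap_h q_lim) simp
    moreover have "((\<lambda>\<epsilon>. (1 / mob P (st_u (X \<epsilon>) j)) *\<^sub>R st_q (Y \<epsilon>) j
          + (1 - \<epsilon>) *\<^sub>R grad_h dx (\<lambda>i. pot P (st_u (X \<epsilon>) i) + st_psi (Y \<epsilon>) i) j
          - (cq P * dx) *\<^sub>R vlap_h dx (st_q (Y \<epsilon>)) j) \<longlongrightarrow> 0) ?F"
    proof (rule Lim_transform_eventually)
      have "((\<lambda>\<epsilon>. - (\<epsilon> * (1 / dt)) *\<^sub>R (st_q (Y \<epsilon>) j - st_q (X \<epsilon>) j)) \<longlongrightarrow> - (0 * (1 / dt)) *\<^sub>R (q j - st_q (C n 0) j)) ?F"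
        by (intro tendsto_scaleR tendsto_mult tendsto_minus tendsto_diff tendsto_const eps q_lim X)
      then show "((\<lambda>\<epsilon>. - (\<epsilon> / dt) *\<^sub>R (st_q (Y \<epsilon>) j - st_q (X \<epsilon>) j)) \<longlongrightarrow> 0) ?F" by simp
      show "\<forall>\<^sub>F \<epsilon> in ?F. - (\<epsilon> / dt) *\<^sub>R (st_q (Y \<epsilon>) j - st_q (X \<epsilon>) j) = (1 / mob P (st_u (X \<epsilon>) j)) *\<^sub>R st_q (Y \<epsilon>) j
          + (1 - \<epsilon>) *\<^sub>R grad_h dx (\<lambda>i. pot P (st_u (X \<epsilon>) i) + st_psi (Y \<epsilon>) i) j
          - (cq P * dx) *\<^sub>R vlap_h dx (st_q (Y \<epsilon>)) j"
        using ev by eventually_elim (simp only: pred(4))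
    qed
    ultimately have "(1 / mob P (u j)) *\<^sub>R q j + (1 - 0) *\<^sub>R grad_h dx (\<lambda>i. pot P (u i) + \<psi> i) j
          - (cq P * dx) *\<^sub>R vlap_h dx q j = 0" by (rule tendsto_unique[OF trivial_limit_at_right_real])
    then show ?thesis by simp
  qed
  have q_flux: "q = flux P dx N u"
  proof (rule flux_eqI[OF assms(2,3) dx u_per])
    show "grid_periodic N q"
    proof (rule grid_periodic_limit[OF q_lim])
      show "\<forall>\<^sub>F \<epsilon> in ?F. grid_periodic N (st_q (Y \<epsilon>))"
        using ev by eventually_elim (use step(2) in \<open>simp add: state_periodic_def\<close>)
    qed
    have w_fun: "w = (\<lambda>j. (- 1) * div_h dx q j + 0)" by (simp add: w_q fun_eq_iff)
    have lap_w: "lap_h dx w = (\<lambda>j. (- 1) * lap_h dx (div_h dx q) j)"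
      using lap_h_linear[of dx "-1" "div_h dx q" "\<lambda>j. 0"] lap_h_linear[of dx "-1" "\<lambda>j. 0" "\<lambda>j. 0"]
      unfolding w_fun by (simp add: fun_eq_iff)
    have chem: "(\<lambda>i. pot P (u i) + \<psi> i) = (\<lambda>i. (- 1) * (gam P * lap_h dx u i - pot P (u i)) + cw P * dx * lap_h dx (div_h dx q) i)"
      by (simp add: \<psi>_def lap_w fun_eq_iff)
    have grad_chem: "grad_h dx (\<lambda>i. pot P (u i) + \<psi> i) = (\<lambda>j. (cw P * dx) *\<^sub>R grad_h dx (lap_h dx (div_h dx q)) j
        - grad_h dx (\<lambda>i. gam P * lap_h dx u i - pot P (u i)) j)"
      using grad_h_linear[of dx "-1" "\<lambda>i. gam P * lap_h dx u i - pot P (u i)" "\<lambda>i. cw P * dx * lap_h dx (div_h dx q) i"]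
        grad_h_linear[of dx "cw P * dx" "lap_h dx (div_h dx q)" "\<lambda>i. 0"] grad_h_linear[of dx "-1" "\<lambda>i. 0" "\<lambda>i. 0"]
      unfolding chem by (simp add: fun_eq_iff)
    show "flux_op P dx (\<lambda>j. mob P (u j)) q = grad_h dx (\<lambda>j. gam P * lap_h dx u j - pot P (u j))"
    proof
      fix j
      show "flux_op P dx (\<lambda>j. mob P (u j)) q j = grad_h dx (\<lambda>j. gam P * lap_h dx u j - pot P (u j)) j"
        using q_eq[of j] unfolding flux_op_def grad_chem by (simp add: algebra_simps)
    qed
  qed
  have update: "st_u (C (Suc n) 0) j = u j - dt * div_h dx q j" for j
  proof -
    have "((\<lambda>\<epsilon>. st_u (X \<epsilon>) j - dt * div_h dx (st_q (Y \<epsilon>)) j + \<epsilon> * (dt * cu P * dt * lap_h dx (\<lambda>i. pot P (st_u (X \<epsilon>) i)) j))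
        \<longlongrightarrow> u j - dt * div_h dx q j + 0 * (dt * cu P * dt * lap_h dx (\<lambda>i. pot P (u i)) j)) ?F"
      by (intro tendsto_intros eps X tendsto_div_h q_lim tendsto_lap_h pot_lim)
    moreover have "\<forall>\<^sub>F \<epsilon> in ?F. st_u (Z \<epsilon>) j = st_u (X \<epsilon>) j - dt * div_h dx (st_q (Y \<epsilon>)) j
        + \<epsilon> * (dt * cu P * dt * lap_h dx (\<lambda>i. pot P (st_u (X \<epsilon>) i)) j)"
      using ev by eventually_elim (simp add: corr(1) pred(1))
    from Lim_transform_eventually[OF Z(1) this]
    have "((\<lambda>\<epsilon>. st_u (X \<epsilon>) j - dt * div_h dx (st_q (Y \<epsilon>)) j + \<epsilon> * (dt * cu P * dt * lap_h dx (\<lambda>i. pot P (st_u (X \<epsilon>) i)) j))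
        \<longlongrightarrow> st_u (C (Suc n) 0) j) ?F" .
    ultimately show ?thesis using tendsto_unique[OF trivial_limit_at_right_real] by force
  qed
  show ?thesis
    by (rule ext) (simp only: limit_scheme_def Let_def update q_flux flip: u_def dx_def)
qed

theorem theorem3p3:
  fixes P :: model and a b :: real
  assumes "a < b" and "standing_assumptions P"
  shows "\<exists>\<Phi> :: ('d::finite) one_step.
    (\<forall>N dt (U :: real \<Rightarrow> nat \<Rightarrow> 'd state) V C n.
       N > 0 \<and> dt > 0 \<and>
       discrete_solution P N ((b - a) / real N) dt U V \<and>
       (\<forall>m. state_expansion (\<lambda>\<epsilon>. U \<epsilon> m) (C m)) \<and>
       well_prepared P N ((b - a) / real N) (\<lambda>\<epsilon>. U \<epsilon> n)
       \<longrightarrow> st_u (C (Suc n) 0) = \<Phi> N dt (st_u (C n 0))) \<and>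
    consistent P a b \<Phi>"
  using relaxation_limit[OF assms] limit_scheme_consistent[OF assms]
  by (intro exI[of _ "limit_scheme P a b"] conjI allI impI) blast+

end
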